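(* Let $L$ be a Lie superalgebra. Then the maximal stem extensions of $L$ are precisely the same as the stem covers of $L$; that is, a stem extension $0\to M\to K\to L\to 0$ of $L$ is maximal if and only if it is a stem cover of $L$.
   Context: All vector superspaces are over a field $\mathbb{F}$ of characteristic different from $2$ and $3$. A Lie superalgebra is a $\mathbb{Z}_2$-graded vector space $L=L_{\bar 0}\oplus L_{\bar 1}$ with a bilinear bracket satisfying, for homogeneous elements, $[L_\alpha,L_\beta]\subseteq L_{\alpha+\beta}$, $[x,y]=-(-1)^{|x||y|}[y,x]$, and $(-1)^{|x||z|}[x,[y,z]]+(-1)^{|y||x|}[y,[z,x]]+(-1)^{|z||y|}[z,[x,y]]=0$. Homomorphisms are bracket-preserving linear maps of even degree (preserving the grading). $K^2=[K,K]$ is the span of all brackets and $Z(K)=\{z\in K:[z,x]=0\ \forall x\in K\}$. The free Lie superalgebra on a $\mathbb{Z}_2$-graded set $X=X_{\bar 0}\cup X_{\bar 1}$ is a Lie superalgebra $F(X)$ with a degree zero map $i:X\to F(X)$ such that for every Lie superalgebra $N$ and every degree zero map $j:X\to N$ there is a unique Lie superalgebra homomorphism $h:F(X)\to N$ with $j=h\circ i$. A free presentation of $L$ is a short exact sequence $0\to R\to F\to L\to 0$ of Lie superalgebras with $F$ a free Lie superalgebra. The Schur multiplier of $L$ is $\mathcal{M}(L)=([F,F]\cap R)/[F,R]$; it is abelian and independent (up to isomorphism) of the choice of free presentation. An extension of $L$ is a short exact sequence $0\to M\to K\xrightarrow{f} L\to 0$ of Lie superalgebras, with $M$ identified with $\ker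 f$. A homomorphism from an extension $f:K\to L$ to an extension $\tilde f:\tilde K\to L$ is a Lie superalgebra homomorphism $g:K\to\tilde K$ with $f=\tilde f\circ g$. An extension is a stem extension if $M\subseteq Z(K)\cap K^2$. A stem extension $0\to M\to K\to L\to 0$ is maximal if every epimorphism (surjective homomorphism of extensions) from any other stem extension of $L$ onto it is necessarily an isomorphism. A stem extension is a stem cover if $M\cong\mathcal{M}(L)$.
   Formalization: "Stem cover implies maximal" is proved for finite-dimensional M(L), since with M ≅ M(L) abstractly it fails otherwise; for arbitrary L, maximal implies stem cover, and maximal is equivalent to the natural map M(L) → M being an isomorphism. *)

theory Defs
  imports "Jordan_Normal_Form.Missing_VectorSpace" "HOL-Library.Z2" "HOL-Algebra.AbelCoset"
begin

text \<open>
  Superspaces are HOL-Algebra modules over a field \<open>K\<close> carrying two homogeneous parts, indexed by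
  \<^typ>\<open>bit\<close> (\<open>gr L 0\<close> is even, \<open>gr L 1\<close> is odd). The fields \<open>mult\<close> and \<open>one\<close> that every module
  record inherits from rings carry no meaning.
\<close>

record ('f, 'v) superalgebra = "('f, 'v) module" +
  gr :: "bit \<Rightarrow> 'v set"
  bracket :: "'v \<Rightarrow> 'v \<Rightarrow> 'v"

text \<open>\<open>koszul L \<alpha> \<beta> x\<close> is \<open>(-1)\<^sup>\<alpha>\<^sup>\<beta> x\<close>.\<close>

definition koszul :: "('f, 'v) superalgebra \<Rightarrow> bit \<Rightarrow> bit \<Rightarrow> 'v \<Rightarrow> 'v" where
  "koszul L \<alpha> \<beta> x = (if \<alpha> = 1 \<and> \<beta> = 1 then \<ominus>\<^bsub>L\<^esub> x else x)"

text \<open>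
  The characteristic restriction on the base field is not built in; it is a hypothesis on \<open>K\<close>.
\<close>

locale lie_superalgebra = vectorspace K L
  for K :: "'f ring" and L :: "('f, 'v) superalgebra" +
  assumes gr_subspace: "subspace K (gr L \<alpha>) L"
    and gr_Int: "gr L 0 \<inter> gr L 1 = {\<zero>\<^bsub>L\<^esub>}"
    and gr_sum: "gr L 0 <+>\<^bsub>L\<^esub> gr L 1 = carrier L"
    and bracket_closed: "\<lbrakk>x \<in> carrier L; y \<in> carrier L\<rbrakk> \<Longrightarrow> bracket L x y \<in> carrier L"
    and bracket_add_left: "\<lbrakk>x \<in> carrier L; y \<in> carrier L; z \<in> carrier L\<rbrakk> \<Longrightarrow>
      bracket L (x \<oplus>\<^bsub>L\<^esub> y) z = bracket L x z \<oplus>\<^bsub>L\<^esub> bracket L y z"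
    and bracket_add_right: "\<lbrakk>x \<in> carrier L; y \<in> carrier L; z \<in> carrier L\<rbrakk> \<Longrightarrow>
      bracket L x (y \<oplus>\<^bsub>L\<^esub> z) = bracket L x y \<oplus>\<^bsub>L\<^esub> bracket L x z"
    and bracket_smult_left: "\<lbrakk>c \<in> carrier K; x \<in> carrier L; y \<in> carrier L\<rbrakk> \<Longrightarrow>
      bracket L (c \<odot>\<^bsub>L\<^esub> x) y = c \<odot>\<^bsub>L\<^esub> bracket L x y"
    and bracket_smult_right: "\<lbrakk>c \<in> carrier K; x \<in> carrier L; y \<in> carrier L\<rbrakk> \<Longrightarrow>
      bracket L x (c \<odot>\<^bsub>L\<^esub> y) = c \<odot>\<^bsub>L\<^esub> bracket L x y"
    and bracket_gr: "\<lbrakk>x \<in> gr L \<alpha>; y \<in> gr L \<beta>\<rbrakk> \<Longrightarrow> bracket L x y \<in> gr L (\<alpha> + \<beta>)"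
    and bracket_skew: "\<lbrakk>x \<in> gr L \<alpha>; y \<in> gr L \<beta>\<rbrakk> \<Longrightarrow>
      bracket L x y = \<ominus>\<^bsub>L\<^esub> koszul L \<alpha> \<beta> (bracket L y x)"
    and jacobi: "\<lbrakk>x \<in> gr L \<alpha>; y \<in> gr L \<beta>; z \<in> gr L \<gamma>\<rbrakk> \<Longrightarrow>
      koszul L \<alpha> \<gamma> (bracket L x (bracket L y z))
        \<oplus>\<^bsub>L\<^esub> koszul L \<beta> \<alpha> (bracket L y (bracket L z x))
        \<oplus>\<^bsub>L\<^esub> koszul L \<gamma> \<beta> (bracket L z (bracket L x y)) = \<zero>\<^bsub>L\<^esub>"

definition lie_hom ::
  "'f ring \<Rightarrow> ('f, 'v) superalgebra \<Rightarrow> ('f, 'w) superalgebra \<Rightarrow> ('v \<Rightarrow> 'w) set" where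
  "lie_hom K A B = {h \<in> module_hom K A B.
     (\<forall>\<alpha>. h ` gr A \<alpha> \<subseteq> gr B \<alpha>) \<and>
     (\<forall>x\<in>carrier A. \<forall>y\<in>carrier A. h (bracket A x y) = bracket B (h x) (h y))}"

definition lie_iso ::
  "'f ring \<Rightarrow> ('f, 'v) superalgebra \<Rightarrow> ('f, 'w) superalgebra \<Rightarrow> ('v \<Rightarrow> 'w) set" where
  "lie_iso K A B = {h \<in> lie_hom K A B. bij_betw h (carrier A) (carrier B)}"

text \<open>\<open>[I, J]\<close> is the span of all brackets; in particular \<open>[A, A]\<close> is the derived algebra.\<close>

definition commutator :: "'f ring \<Rightarrow> ('f, 'v) superalgebra \<Rightarrow> 'v set \<Rightarrow> 'v set \<Rightarrow> 'v set" where
  "commutator K A I J = module.span K A {bracket A x y | x y. x \<in> I \<and> y \<in> J}"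

abbreviation derived :: "'f ring \<Rightarrow> ('f, 'v) superalgebra \<Rightarrow> 'v set" where
  "derived K A \<equiv> commutator K A (carrier A) (carrier A)"

definition lie_center :: "('f, 'v) superalgebra \<Rightarrow> 'v set" where
  "lie_center A = {z \<in> carrier A. \<forall>x\<in>carrier A. bracket A z x = \<zero>\<^bsub>A\<^esub>}"

definition sub_superalgebra :: "('f, 'v) superalgebra \<Rightarrow> 'v set \<Rightarrow> ('f, 'v) superalgebra" where
  "sub_superalgebra A S = A\<lparr>carrier := S, gr := \<lambda>\<alpha>. gr A \<alpha> \<inter> S\<rparr>"

text \<open>Quotient by a graded ideal \<open>I\<close>, with cosets as elements (compare \<^const>\<open>A_FactGroup\<close>).\<close>

definition quot_superalgebra ::
  "('f, 'v) superalgebra \<Rightarrow> 'v set \<Rightarrow> ('f, 'v set) superalgebra" where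
  "quot_superalgebra A I =
     \<lparr>carrier = a_rcosets\<^bsub>A\<^esub> I, mult = (\<lambda>X Y. I), one = I,
      zero = I, add = set_add A,
      smult = (\<lambda>c X. \<Union>x\<in>X. I +>\<^bsub>A\<^esub> (c \<odot>\<^bsub>A\<^esub> x)),
      gr = (\<lambda>\<alpha>. (\<lambda>x. I +>\<^bsub>A\<^esub> x) ` gr A \<alpha>),
      bracket = (\<lambda>X Y. \<Union>x\<in>X. \<Union>y\<in>Y. I +>\<^bsub>A\<^esub> bracket A x y)\<rparr>"

text \<open>
  The universal property of the free Lie superalgebra on the graded set \<open>X 0 \<union> X 1\<close> quantifies over
  all Lie superalgebras \<open>N\<close>. A formula cannot quantify over types, so \<open>N\<close> ranges over the structures
  on the type \<open>('x + 'f + 'a) list\<close>. This is no restriction: that type is infinite and at least as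
  large as \<open>'x\<close>, \<open>'f\<close> and \<open>'a\<close>, hence it contains a copy of \<open>F\<close> and a copy of every Lie
  superalgebra over \<open>K\<close> generated by an image of \<open>X\<close>, in particular of the genuine free one, and
  testing against these two determines \<open>F\<close> up to isomorphism. Homomorphisms are compared on the
  carrier only, through \<^const>\<open>extensional\<close>.
\<close>

definition free_lie_superalgebra ::
  "'f ring \<Rightarrow> (bit \<Rightarrow> 'x set) \<Rightarrow> ('x \<Rightarrow> 'a) \<Rightarrow> ('f, 'a) superalgebra \<Rightarrow> bool" where
  "free_lie_superalgebra K X i F \<longleftrightarrow>
     lie_superalgebra K F \<and> X 0 \<inter> X 1 = {} \<and> (\<forall>\<alpha>. i ` X \<alpha> \<subseteq> gr F \<alpha>) \<and>
     (\<forall>(N :: ('f, ('x + 'f + 'a) list) superalgebra) j.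
        lie_superalgebra K N \<and> (\<forall>\<alpha>. j ` X \<alpha> \<subseteq> gr N \<alpha>) \<longrightarrow>
        (\<exists>!h. h \<in> lie_hom K F N \<and> h \<in> extensional (carrier F) \<and>
              (\<forall>\<alpha>. \<forall>x\<in>X \<alpha>. h (i x) = j x)))"

text \<open>A short exact sequence \<open>0 \<rightarrow> M \<rightarrow> A \<rightarrow> L \<rightarrow> 0\<close> is given by \<open>f : A \<rightarrow> L\<close>, with \<open>M\<close> its kernel.\<close>

definition lie_extension ::
  "'f ring \<Rightarrow> ('f, 'l) superalgebra \<Rightarrow> ('f, 'a) superalgebra \<Rightarrow> ('a \<Rightarrow> 'l) \<Rightarrow> bool" where
  "lie_extension K L A f \<longleftrightarrow>
     lie_superalgebra K A \<and> lie_superalgebra K L \<and>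
     f \<in> lie_hom K A L \<and> f ` carrier A = carrier L"

definition free_presentation ::
  "'f ring \<Rightarrow> ('f, 'l) superalgebra \<Rightarrow> (bit \<Rightarrow> 'x set) \<Rightarrow> ('x \<Rightarrow> 'a) \<Rightarrow>
   ('f, 'a) superalgebra \<Rightarrow> ('a \<Rightarrow> 'l) \<Rightarrow> bool" where
  "free_presentation K L X i F \<pi> \<longleftrightarrow> free_lie_superalgebra K X i F \<and> lie_extension K L F \<pi>"

text \<open>\<open>([F, F] \<inter> R) / [F, R]\<close> where \<open>R = ker \<pi>\<close>\<close>

definition schur_multiplier ::
  "'f ring \<Rightarrow> ('f, 'l) superalgebra \<Rightarrow> ('f, 'a) superalgebra \<Rightarrow> ('a \<Rightarrow> 'l) \<Rightarrow>
   ('f, 'a set) superalgebra" where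
  "schur_multiplier K L F \<pi> =
     (let R = a_kernel F L \<pi>
      in quot_superalgebra (sub_superalgebra F (derived K F \<inter> R)) (commutator K F (carrier F) R))"

definition extension_hom ::
  "'f ring \<Rightarrow> ('f, 'a) superalgebra \<Rightarrow> ('a \<Rightarrow> 'l) \<Rightarrow> ('f, 'b) superalgebra \<Rightarrow> ('b \<Rightarrow> 'l) \<Rightarrow>
   ('a \<Rightarrow> 'b) set" where
  "extension_hom K A f B f' = {g \<in> lie_hom K A B. \<forall>x\<in>carrier A. f x = f' (g x)}"

definition stem_extension ::
  "'f ring \<Rightarrow> ('f, 'l) superalgebra \<Rightarrow> ('f, 'a) superalgebra \<Rightarrow> ('a \<Rightarrow> 'l) \<Rightarrow> bool" where
  "stem_extension K L A f \<longleftrightarrow>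
     lie_extension K L A f \<and> a_kernel A L f \<subseteq> lie_center A \<inter> derived K A"

text \<open>
  The competing stem extensions live on the type \<open>'l list\<close>. Every stem extension \<open>f : B \<rightarrow> L\<close> has an
  isomorphic copy there: with a set-theoretic section \<open>s\<close> of \<open>f\<close>, every element of \<open>B\<close> has the form
  \<open>s x + [s x\<^sub>1, s y\<^sub>1] + \<dots> + [s x\<^sub>n, s y\<^sub>n]\<close>, because the kernel is central and lies in \<open>[B, B]\<close>,
  so \<open>B\<close> is an image of the set of lists \<open>x, x\<^sub>1, y\<^sub>1, \<dots>, x\<^sub>n, y\<^sub>n\<close> over \<open>L\<close>.
\<close>

definition maximal_stem_extension ::
  "'f ring \<Rightarrow> ('f, 'l) superalgebra \<Rightarrow> ('f, 'a) superalgebra \<Rightarrow> ('a \<Rightarrow> 'l) \<Rightarrow> bool" where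
  "maximal_stem_extension K L A f \<longleftrightarrow>
     stem_extension K L A f \<and>
     (\<forall>(B :: ('f, 'l list) superalgebra) f' g.
        stem_extension K L B f' \<and> g \<in> extension_hom K B f' A f \<and> g ` carrier B = carrier A \<longrightarrow>
        g \<in> lie_iso K B A)"

text \<open>\<open>M \<cong> M(L)\<close> as an abstract isomorphism\<close>

definition stem_cover ::
  "'f ring \<Rightarrow> ('f, 'l) superalgebra \<Rightarrow> ('f, 'p) superalgebra \<Rightarrow> ('p \<Rightarrow> 'l) \<Rightarrow>
   ('f, 'a) superalgebra \<Rightarrow> ('a \<Rightarrow> 'l) \<Rightarrow> bool" where
  "stem_cover K L F \<pi> A f \<longleftrightarrow>
     stem_extension K L A f \<and>
     lie_iso K (sub_superalgebra A (a_kernel A L f)) (schur_multiplier K L F \<pi>) \<noteq> {}"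

text \<open>
  A homomorphism \<open>\<beta> : F \<rightarrow> A\<close> over \<open>L\<close> induces a map from \<open>M(L)\<close> to \<open>M = ker f\<close>, sending the coset
  of \<open>x\<close> to \<open>\<beta> x\<close>; it is independent of \<open>\<beta>\<close> since \<open>M\<close> is central, and it is onto since
  \<open>M \<subseteq> [A, A]\<close>. Here this natural map, rather than an arbitrary one, is required to be an
  isomorphism. If \<open>M(L)\<close> is finite-dimensional, then the two notions coincide. Otherwise they
  differ: a quotient of \<open>M(L)\<close> by a proper non-zero subspace can be isomorphic to \<open>M(L)\<close>.
\<close>

definition natural_stem_cover ::
  "'f ring \<Rightarrow> ('f, 'l) superalgebra \<Rightarrow> ('f, 'p) superalgebra \<Rightarrow> ('p \<Rightarrow> 'l) \<Rightarrow>
   ('f, 'a) superalgebra \<Rightarrow> ('a \<Rightarrow> 'l) \<Rightarrow> bool" where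
  "natural_stem_cover K L F \<pi> A f \<longleftrightarrow>
     stem_extension K L A f \<and>
     (\<exists>\<beta> \<in> extension_hom K F \<pi> A f.
        (\<lambda>X. the_elem (\<beta> ` X))
          \<in> lie_iso K (schur_multiplier K L F \<pi>) (sub_superalgebra A (a_kernel A L f)))"

end

theory Submission
  imports Defs
begin

text \<open>
  Let \<open>R = ker \<pi>\<close>, \<open>D = [F, F]\<close> and \<open>I = [F, R]\<close>. Every stem extension \<open>g : B \<rightarrow> L\<close> receives a
  homomorphism \<open>\<beta> : F \<rightarrow> B\<close> over \<open>L\<close>; it is onto, vanishes on \<open>I\<close>, maps \<open>D \<inter> R\<close> onto \<open>ker g\<close>, and
  its restriction to \<open>D\<close> does not depend on the choice of \<open>\<beta>\<close>. Hence the natural map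
  \<open>(D \<inter> R) / I \<rightarrow> ker g\<close> is an isomorphism iff \<open>D \<inter> ker \<beta> \<subseteq> I\<close>. If this holds, an epimorphism
  \<open>h : C \<rightarrow> B\<close> of stem extensions is injective, since an element of \<open>ker h\<close> is the image of some
  \<open>d \<in> D\<close>, and \<open>\<beta> d = 0\<close>. Conversely, Zorn's lemma gives a graded complement \<open>T\<close> with
  \<open>I \<subseteq> T \<subseteq> ker \<beta> \<subseteq> T + D\<close> and \<open>T \<inter> D \<subseteq> I\<close>. Then \<open>F / T\<close> is a stem extension of \<open>L\<close>
  mapping onto \<open>B\<close>, so maximality of \<open>B\<close> forces \<open>ker \<beta> = T\<close>. In finite dimension any abstract
  isomorphism of \<open>ker g\<close> with the multiplier makes the natural surjection injective.
\<close>

section \<open>Homomorphic images of Lie superalgebras\<close>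

lemma (in module) submodule_neg: "\<lbrakk>submodule R N M; v \<in> N\<rbrakk> \<Longrightarrow> \<ominus>\<^bsub>M\<^esub> v \<in> N"
  by (metis R.add.inv_closed R.one_closed smult_minus_1 submodule.smult_closed submodule.subset subsetD)

lemma (in module) submodule_minus:
  "\<lbrakk>submodule R N M; v \<in> N; w \<in> N\<rbrakk> \<Longrightarrow> v \<ominus>\<^bsub>M\<^esub> w \<in> N"
  unfolding a_minus_def by (simp add: submodule_neg submodule.m_closed)

context lie_superalgebra
begin

lemma gr_submodule: "submodule K (gr L \<alpha>) L"
  using gr_subspace by (rule subspace.submod)

lemma gr_closed [simp]: "x \<in> gr L \<alpha> \<Longrightarrow> x \<in> carrier L"
  by (rule subsetD[OF submodule.subset[OF gr_submodule]])

lemma gr_zero [simp]: "\<zero>\<^bsub>L\<^esub> \<in> gr L \<alpha>"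
  by (rule submodule.zero_closed[OF gr_submodule])

lemma gr_add: "\<lbrakk>x \<in> gr L \<alpha>; y \<in> gr L \<alpha>\<rbrakk> \<Longrightarrow> x \<oplus>\<^bsub>L\<^esub> y \<in> gr L \<alpha>"
  by (rule submodule.m_closed[OF gr_submodule])

lemma gr_smult: "\<lbrakk>c \<in> carrier K; x \<in> gr L \<alpha>\<rbrakk> \<Longrightarrow> c \<odot>\<^bsub>L\<^esub> x \<in> gr L \<alpha>"
  by (rule submodule.smult_closed[OF gr_submodule])

lemma gr_neg: "x \<in> gr L \<alpha> \<Longrightarrow> \<ominus>\<^bsub>L\<^esub> x \<in> gr L \<alpha>"
  by (rule submodule_neg[OF gr_submodule])

lemma gr_minus: "\<lbrakk>x \<in> gr L \<alpha>; y \<in> gr L \<alpha>\<rbrakk> \<Longrightarrow> x \<ominus>\<^bsub>L\<^esub> y \<in> gr L \<alpha>"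
  by (rule submodule_minus[OF gr_submodule])

lemma minus_eq_zero_iff: "\<lbrakk>x \<in> carrier L; y \<in> carrier L\<rbrakk> \<Longrightarrow> x \<ominus>\<^bsub>L\<^esub> y = \<zero>\<^bsub>L\<^esub> \<longleftrightarrow> x = y"
  by simp

lemma gr_decomp:
  assumes "x \<in> carrier L"
  obtains x0 x1 where "x0 \<in> gr L 0" "x1 \<in> gr L 1" "x = x0 \<oplus>\<^bsub>L\<^esub> x1"
  using assms gr_sum unfolding set_add_def' by blast

text \<open>The element \<open>x0 - y0 = y1 - x1\<close> lies in both homogeneous parts, which meet
  only in zero.\<close>

lemma gr_decomp_unique:
  assumes "x0 \<in> gr L 0" "x1 \<in> gr L 1" "y0 \<in> gr L 0" "y1 \<in> gr L 1"
    and eq: "x0 \<oplus>\<^bsub>L\<^esub> x1 = y0 \<oplus>\<^bsub>L\<^esub> y1"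
  shows "x0 = y0" "x1 = y1"
proof -
  have c: "x0 \<in> carrier L" "x1 \<in> carrier L" "y0 \<in> carrier L" "y1 \<in> carrier L"
    using assms by auto
  have "x0 = (y0 \<oplus>\<^bsub>L\<^esub> y1) \<ominus>\<^bsub>L\<^esub> x1"
    unfolding eq[symmetric] using c by (simp add: a_minus_def M.add.m_assoc M.r_neg)
  also have "\<dots> = y0 \<oplus>\<^bsub>L\<^esub> (y1 \<ominus>\<^bsub>L\<^esub> x1)"
    using c by (simp add: a_minus_def M.add.m_assoc)
  finally have "x0 \<ominus>\<^bsub>L\<^esub> y0 = y1 \<ominus>\<^bsub>L\<^esub> x1"
    using c by (simp add: a_minus_def M.a_comm[of y0] M.a_assoc M.r_neg)
  then have "x0 \<ominus>\<^bsub>L\<^esub> y0 \<in> gr L 0 \<inter> gr L 1"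
    using assms by (metis IntI gr_minus)
  then show 1: "x0 = y0" using gr_Int c by simp
  show "x1 = y1" using eq c unfolding 1 by simp
qed

lemma bracket_zero_left [simp]: "x \<in> carrier L \<Longrightarrow> bracket L \<zero>\<^bsub>L\<^esub> x = \<zero>\<^bsub>L\<^esub>"
  using bracket_smult_left[of "\<zero>\<^bsub>K\<^esub>" "\<zero>\<^bsub>L\<^esub>" x] by (simp add: bracket_closed)

lemma bracket_zero_right [simp]: "x \<in> carrier L \<Longrightarrow> bracket L x \<zero>\<^bsub>L\<^esub> = \<zero>\<^bsub>L\<^esub>"
  using bracket_smult_right[of "\<zero>\<^bsub>K\<^esub>" x "\<zero>\<^bsub>L\<^esub>"] by (simp add: bracket_closed)

end

text \<open>In a Lie superalgebra, where even and odd components are unique, the second conjunct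
  says that \<open>S\<close> is the sum of its intersections with the two homogeneous parts.\<close>

definition graded_submodule :: "'f ring \<Rightarrow> ('f, 'v) superalgebra \<Rightarrow> 'v set \<Rightarrow> bool" where
  "graded_submodule K A S \<longleftrightarrow> submodule K S A \<and>
     (\<forall>x\<in>gr A 0. \<forall>y\<in>gr A 1. x \<oplus>\<^bsub>A\<^esub> y \<in> S \<longrightarrow> x \<in> S \<and> y \<in> S)"

lemma graded_submoduleD:
  assumes "graded_submodule K A S"
  shows "submodule K S A"
    and "\<lbrakk>x \<in> gr A 0; y \<in> gr A 1; x \<oplus>\<^bsub>A\<^esub> y \<in> S\<rbrakk> \<Longrightarrow> x \<in> S"
    and "\<lbrakk>x \<in> gr A 0; y \<in> gr A 1; x \<oplus>\<^bsub>A\<^esub> y \<in> S\<rbrakk> \<Longrightarrow> y \<in> S"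
  using assms by (auto simp: graded_submodule_def)

lemma graded_submodule_Int:
  assumes "graded_submodule K A S" "graded_submodule K A T"
  shows "graded_submodule K A (S \<inter> T)"
  using assms unfolding graded_submodule_def submodule_def by blast

text \<open>Nothing is presupposed about \<open>V\<close> as a module: each axiom is pulled back to
  \<open>A\<close> along the surjection. The same argument thus serves quotients, copies on another
  type and substructures.\<close>

lemma vectorspace_image:
  assumes "vectorspace K A"
    and im: "h ` carrier A = carrier V"
    and zero: "h \<zero>\<^bsub>A\<^esub> = \<zero>\<^bsub>V\<^esub>"
    and add: "\<And>x y. \<lbrakk>x \<in> carrier A; y \<in> carrier A\<rbrakk> \<Longrightarrow> h (x \<oplus>\<^bsub>A\<^esub> y) = h x \<oplus>\<^bsub>V\<^esub> h y"
    and smult: "\<And>c x. \<lbrakk>c \<in> carrier K; x \<in> carrier A\<rbrakk> \<Longrightarrow> h (c \<odot>\<^bsub>A\<^esub> x) = c \<odot>\<^bsub>V\<^esub> h x"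
  shows "vectorspace K V"
proof -
  interpret A: vectorspace K A by fact
  have "field K" ..
  then show ?thesis
  proof (rule vs_criteria)
    have ex: "\<And>v. v \<in> carrier V \<longleftrightarrow> (\<exists>x\<in>carrier A. v = h x)" using im by auto
    note simps = ex add[symmetric] smult[symmetric] zero[symmetric]
    show "\<zero>\<^bsub>V\<^esub> \<in> carrier V" using im zero by (metis A.M.zero_closed image_eqI)
    show "\<forall>v w. v \<in> carrier V \<and> w \<in> carrier V \<longrightarrow> v \<oplus>\<^bsub>V\<^esub> w \<in> carrier V"
      by (auto simp: simps)
    show "\<forall>v\<in>carrier V. \<exists>neg_v\<in>carrier V. v \<oplus>\<^bsub>V\<^esub> neg_v = \<zero>\<^bsub>V\<^esub>"
    proof
      fix v assume "v \<in> carrier V"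
      then obtain x where x: "x \<in> carrier A" "v = h x" using ex by blast
      then have "v \<oplus>\<^bsub>V\<^esub> h (\<ominus>\<^bsub>A\<^esub> x) = \<zero>\<^bsub>V\<^esub>" by (simp add: simps A.M.r_neg)
      then show "\<exists>neg_v\<in>carrier V. v \<oplus>\<^bsub>V\<^esub> neg_v = \<zero>\<^bsub>V\<^esub>" using x im by blast
    qed
    show "\<forall>c v. c \<in> carrier K \<and> v \<in> carrier V \<longrightarrow> c \<odot>\<^bsub>V\<^esub> v \<in> carrier V"
      by (auto simp: simps)
    show "\<forall>v w. v \<in> carrier V \<and> w \<in> carrier V \<longrightarrow> v \<oplus>\<^bsub>V\<^esub> w = w \<oplus>\<^bsub>V\<^esub> v"
      by (auto simp: simps A.M.a_comm)
    show "\<forall>v w x. v \<in> carrier V \<and> w \<in> carrier V \<and> x \<in> carrier V \<longrightarrow>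
        (v \<oplus>\<^bsub>V\<^esub> w) \<oplus>\<^bsub>V\<^esub> x = v \<oplus>\<^bsub>V\<^esub> (w \<oplus>\<^bsub>V\<^esub> x)"
      by (auto simp: simps A.M.a_assoc)
    show "\<forall>v\<in>carrier V. v \<oplus>\<^bsub>V\<^esub> \<zero>\<^bsub>V\<^esub> = v"
      by (auto simp: simps)
    show "\<forall>a b v. a \<in> carrier K \<and> b \<in> carrier K \<and> v \<in> carrier V \<longrightarrow>
        (a \<otimes>\<^bsub>K\<^esub> b) \<odot>\<^bsub>V\<^esub> v = a \<odot>\<^bsub>V\<^esub> (b \<odot>\<^bsub>V\<^esub> v)"
      by (auto simp: simps A.smult_assoc1)
    show "\<forall>v\<in>carrier V. \<one>\<^bsub>K\<^esub> \<odot>\<^bsub>V\<^esub> v = v"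
      by (auto simp: simps)
    show "\<forall>a b v. a \<in> carrier K \<and> b \<in> carrier K \<and> v \<in> carrier V \<longrightarrow>
        (a \<oplus>\<^bsub>K\<^esub> b) \<odot>\<^bsub>V\<^esub> v = a \<odot>\<^bsub>V\<^esub> v \<oplus>\<^bsub>V\<^esub> b \<odot>\<^bsub>V\<^esub> v"
      by (auto simp: simps A.smult_l_distr)
    show "\<forall>a v w. a \<in> carrier K \<and> v \<in> carrier V \<and> w \<in> carrier V \<longrightarrow>
        a \<odot>\<^bsub>V\<^esub> (v \<oplus>\<^bsub>V\<^esub> w) = a \<odot>\<^bsub>V\<^esub> v \<oplus>\<^bsub>V\<^esub> a \<odot>\<^bsub>V\<^esub> w"
      by (auto simp: simps A.smult_r_distr)
  qed
qed

text \<open>Identities pass along a surjection that respects the operations. The exception is that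
  the even and odd parts of \<open>V\<close> meet only in zero; this needs the kernel to be graded,
  which is the role of \<open>ker\<close>.\<close>

lemma lie_superalgebra_image:
  assumes "lie_superalgebra K A"
    and im: "h ` carrier A = carrier V"
    and zero: "h \<zero>\<^bsub>A\<^esub> = \<zero>\<^bsub>V\<^esub>"
    and add: "\<And>x y. \<lbrakk>x \<in> carrier A; y \<in> carrier A\<rbrakk> \<Longrightarrow> h (x \<oplus>\<^bsub>A\<^esub> y) = h x \<oplus>\<^bsub>V\<^esub> h y"
    and smult: "\<And>c x. \<lbrakk>c \<in> carrier K; x \<in> carrier A\<rbrakk> \<Longrightarrow> h (c \<odot>\<^bsub>A\<^esub> x) = c \<odot>\<^bsub>V\<^esub> h x"
    and brk: "\<And>x y. \<lbrakk>x \<in> carrier A; y \<in> carrier A\<rbrakk> \<Longrightarrow>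
      h (bracket A x y) = bracket V (h x) (h y)"
    and gr: "\<And>\<alpha>. h ` gr A \<alpha> = gr V \<alpha>"
    and ker: "\<And>x y. \<lbrakk>x \<in> gr A 0; y \<in> gr A 1; h (x \<oplus>\<^bsub>A\<^esub> y) = \<zero>\<^bsub>V\<^esub>\<rbrakk> \<Longrightarrow> h x = \<zero>\<^bsub>V\<^esub>"
  shows "lie_superalgebra K V"
proof -
  interpret A: lie_superalgebra K A by fact
  interpret V: vectorspace K V
    by (rule vectorspace_image[OF A.vectorspace_axioms im zero add smult])
  interpret lm: linear_map K A V h
    by unfold_locales (use im add smult in \<open>auto simp: module_hom_def\<close>)
  have ex: "\<And>v. v \<in> carrier V \<longleftrightarrow> (\<exists>x\<in>carrier A. v = h x)" using im by auto
  have exg: "\<And>v \<alpha>. v \<in> gr V \<alpha> \<longleftrightarrow> (\<exists>x\<in>gr A \<alpha>. v = h x)" unfolding gr[symmetric] by auto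
  have kz: "h (koszul A \<alpha> \<beta> x) = koszul V \<alpha> \<beta> (h x)" if "x \<in> carrier A" for \<alpha> \<beta> x
    using that by (simp add: koszul_def)
  have kc: "koszul A \<alpha> \<beta> x \<in> carrier A" if "x \<in> carrier A" for \<alpha> \<beta> x
    using that by (simp add: koszul_def)
  show ?thesis
  proof (intro lie_superalgebra.intro lie_superalgebra_axioms.intro V.vectorspace_axioms)
    fix \<alpha> show "subspace K (gr V \<alpha>) V"
    proof (unfold_locales)
      show "gr V \<alpha> \<subseteq> carrier V" by (auto simp: exg)
      show "\<zero>\<^bsub>V\<^esub> \<in> gr V \<alpha>" by (metis A.gr_zero exg zero)
      fix v w assume "v \<in> gr V \<alpha>" "w \<in> gr V \<alpha>"
      then show "v \<oplus>\<^bsub>V\<^esub> w \<in> gr V \<alpha>" unfolding exg by (metis A.gr_add A.gr_closed add)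
    next
      fix c v assume "c \<in> carrier K" "v \<in> gr V \<alpha>"
      then show "c \<odot>\<^bsub>V\<^esub> v \<in> gr V \<alpha>" unfolding exg by (metis A.gr_smult A.gr_closed smult)
    qed
  next
    show "gr V 0 \<inter> gr V 1 = {\<zero>\<^bsub>V\<^esub>}"
    proof
      show "gr V 0 \<inter> gr V 1 \<subseteq> {\<zero>\<^bsub>V\<^esub>}"
      proof
        fix v assume "v \<in> gr V 0 \<inter> gr V 1"
        then obtain x y where xy: "x \<in> gr A 0" "y \<in> gr A 1" "v = h x" "v = h y"
          by (auto simp: exg)
        \<comment> \<open>A common image of an even \<open>x\<close> and an odd \<open>y\<close>
          gives the kernel element \<open>x - y\<close>, whose homogeneous components are
          \<open>x\<close> and \<open>-y\<close>.\<close>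
        then have "h (x \<oplus>\<^bsub>A\<^esub> \<ominus>\<^bsub>A\<^esub> y) = \<zero>\<^bsub>V\<^esub>"
          by (simp add: A.gr_closed V.M.r_neg)
        then show "v \<in> {\<zero>\<^bsub>V\<^esub>}" using ker xy by (metis A.gr_neg singletonI)
      qed
      show "{\<zero>\<^bsub>V\<^esub>} \<subseteq> gr V 0 \<inter> gr V 1" using A.gr_zero zero gr by (metis IntI empty_subsetI image_eqI insert_subset)
    qed
    show "gr V 0 <+>\<^bsub>V\<^esub> gr V 1 = carrier V"
    proof
      show "gr V 0 <+>\<^bsub>V\<^esub> gr V 1 \<subseteq> carrier V" by (auto simp: exg set_add_def')
      show "carrier V \<subseteq> gr V 0 <+>\<^bsub>V\<^esub> gr V 1"
      proof
        fix v assume "v \<in> carrier V"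
        then obtain x where "x \<in> carrier A" "v = h x" using ex by blast
        then obtain x0 x1 where "x0 \<in> gr A 0" "x1 \<in> gr A 1" "v = h x0 \<oplus>\<^bsub>V\<^esub> h x1"
          by (metis A.gr_closed A.gr_decomp add)
        then show "v \<in> gr V 0 <+>\<^bsub>V\<^esub> gr V 1"
          unfolding set_add_def' gr[symmetric] by blast
      qed
    qed
  next
    fix x y z assume "x \<in> carrier V" "y \<in> carrier V"
    then show "bracket V x y \<in> carrier V"
      by (auto simp: ex brk[symmetric] A.bracket_closed)
    assume "z \<in> carrier V"
    with \<open>x \<in> carrier V\<close> \<open>y \<in> carrier V\<close> obtain a b c where
      "a \<in> carrier A" "b \<in> carrier A" "c \<in> carrier A" "x = h a" "y = h b" "z = h c"
      unfolding ex by blast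
    then show "bracket V (x \<oplus>\<^bsub>V\<^esub> y) z = bracket V x z \<oplus>\<^bsub>V\<^esub> bracket V y z"
      "bracket V x (y \<oplus>\<^bsub>V\<^esub> z) = bracket V x y \<oplus>\<^bsub>V\<^esub> bracket V x z"
      by (simp_all add: brk[symmetric] add[symmetric] A.bracket_closed A.bracket_add_left
        A.bracket_add_right del: lm.f_add)
  next
    fix c x y assume "c \<in> carrier K" "x \<in> carrier V" "y \<in> carrier V"
    then obtain a b where "a \<in> carrier A" "b \<in> carrier A" "x = h a" "y = h b"
      unfolding ex by blast
    then show "bracket V (c \<odot>\<^bsub>V\<^esub> x) y = c \<odot>\<^bsub>V\<^esub> bracket V x y"
      "bracket V x (c \<odot>\<^bsub>V\<^esub> y) = c \<odot>\<^bsub>V\<^esub> bracket V x y"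
      using \<open>c \<in> carrier K\<close> by (simp_all add: brk[symmetric] smult[symmetric] A.bracket_closed
        A.bracket_smult_left A.bracket_smult_right del: lm.f_smult)
  next
    fix x y \<alpha> \<beta> assume "x \<in> gr V \<alpha>" "y \<in> gr V \<beta>"
    then obtain a b where ab: "a \<in> gr A \<alpha>" "b \<in> gr A \<beta>" "x = h a" "y = h b"
      unfolding exg by blast
    then show "bracket V x y \<in> gr V (\<alpha> + \<beta>)"
      unfolding exg by (metis A.bracket_gr A.gr_closed brk)
    show "bracket V x y = \<ominus>\<^bsub>V\<^esub> koszul V \<alpha> \<beta> (bracket V y x)"
    proof -
      have "bracket V x y = h (\<ominus>\<^bsub>A\<^esub> koszul A \<alpha> \<beta> (bracket A b a))"
        using ab by (simp add: brk[symmetric] A.gr_closed A.bracket_skew[of a \<alpha> b \<beta>] del: lm.f_neg)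
      then show ?thesis using ab by (simp add: brk kz kc A.bracket_closed A.gr_closed)
    qed
  next
    fix x y z \<alpha> \<beta> \<gamma> assume "x \<in> gr V \<alpha>" "y \<in> gr V \<beta>" "z \<in> gr V \<gamma>"
    then obtain a b c where abc: "a \<in> gr A \<alpha>" "b \<in> gr A \<beta>" "c \<in> gr A \<gamma>" "x = h a" "y = h b" "z = h c"
      unfolding exg by blast
    then show "koszul V \<alpha> \<gamma> (bracket V x (bracket V y z))
        \<oplus>\<^bsub>V\<^esub> koszul V \<beta> \<alpha> (bracket V y (bracket V z x))
        \<oplus>\<^bsub>V\<^esub> koszul V \<gamma> \<beta> (bracket V z (bracket V x y)) = \<zero>\<^bsub>V\<^esub>"
      using arg_cong[OF A.jacobi[of a \<alpha> b \<beta> c \<gamma>], of h]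
      by (simp add: kz kc brk A.bracket_closed A.gr_closed zero)
  qed
qed

section \<open>Homomorphisms, substructures and quotients\<close>

lemma (in module) submodule_abelian_subgroup:
  assumes "submodule R N M"
  shows "abelian_subgroup N M"
proof (rule abelian_subgroupI3)
  interpret submodule R N M by fact
  have "subgroup N (add_monoid M)"
  proof (rule M.add.subgroupI)
    show "N \<noteq> {}" using zero_closed by blast
  qed (use subset submodule_neg[OF assms] in auto)
  then show "additive_subgroup N M" by (rule additive_subgroupI)
  show "abelian_group M" ..
qed

locale lie_morphism = A: lie_superalgebra K A + B: lie_superalgebra K B
  for K :: "'f ring" and A :: "('f, 'v) superalgebra" and B :: "('f, 'w) superalgebra" +
  fixes h :: "'v \<Rightarrow> 'w"
  assumes lie_hom: "h \<in> lie_hom K A B"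
begin

sublocale lin: linear_map K A B h
  by unfold_locales (use lie_hom in \<open>simp add: lie_hom_def\<close>)

lemma gr: "x \<in> gr A \<alpha> \<Longrightarrow> h x \<in> gr B \<alpha>"
  using lie_hom by (auto simp: lie_hom_def)

lemma bracket [simp]: "\<lbrakk>x \<in> carrier A; y \<in> carrier A\<rbrakk> \<Longrightarrow> h (bracket A x y) = bracket B (h x) (h y)"
  using lie_hom by (auto simp: lie_hom_def)

text \<open>Split any preimage of a homogeneous element into components. By uniqueness of components
  in \<open>B\<close>, the one of the wrong degree is sent to zero, so the other is already a
  homogeneous preimage.\<close>

lemma gr_surj:
  assumes "h ` carrier A = carrier B"
  shows "h ` gr A \<alpha> = gr B \<alpha>"
proof
  show "h ` gr A \<alpha> \<subseteq> gr B \<alpha>" using gr by blast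
  show "gr B \<alpha> \<subseteq> h ` gr A \<alpha>"
  proof
    fix b assume b: "b \<in> gr B \<alpha>"
    then obtain a where "a \<in> carrier A" "b = h a" using assms by (metis B.gr_closed imageE)
    then obtain x y where xy: "x \<in> gr A 0" "y \<in> gr A 1" "b = h x \<oplus>\<^bsub>B\<^esub> h y"
      by (metis A.gr_decomp A.gr_closed lin.f_add)
    have h: "h x \<in> gr B 0" "h y \<in> gr B 1" using xy gr by auto
    show "b \<in> h ` gr A \<alpha>"
    proof (cases "\<alpha> = 0")
      case True
      then have "b = h x"
        using B.gr_decomp_unique[of b "\<zero>\<^bsub>B\<^esub>" "h x" "h y"] b xy(3) h by simp
      then show ?thesis using xy True by blast
    next
      case False
      then have "b = h y"
        using B.gr_decomp_unique[of "\<zero>\<^bsub>B\<^esub>" b "h x" "h y"] b xy(3) h by simp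
      then show ?thesis using xy False by simp
    qed
  qed
qed

lemma ker_submodule: "submodule K (a_kernel A B h) A"
  using lin.kerT_is_subspace subspace.submod by (auto simp: a_kernel_def' lin.ker_def)

lemma ker_graded: "graded_submodule K A (a_kernel A B h)"
  unfolding graded_submodule_def
proof (intro conjI ballI impI ker_submodule)
  fix x y assume xy: "x \<in> gr A 0" "y \<in> gr A 1" "x \<oplus>\<^bsub>A\<^esub> y \<in> a_kernel A B h"
  then have "h x \<oplus>\<^bsub>B\<^esub> h y = \<zero>\<^bsub>B\<^esub> \<oplus>\<^bsub>B\<^esub> \<zero>\<^bsub>B\<^esub>"
    by (simp add: a_kernel_def')
  then have "h x = \<zero>\<^bsub>B\<^esub> \<and> h y = \<zero>\<^bsub>B\<^esub>"
    using B.gr_decomp_unique[of "h x" "h y" "\<zero>\<^bsub>B\<^esub>" "\<zero>\<^bsub>B\<^esub>"] gr xy by simp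
  then show "x \<in> a_kernel A B h" "y \<in> a_kernel A B h" using xy by (simp_all add: a_kernel_def')
qed

lemma eq_iff_minus: "\<lbrakk>x \<in> carrier A; y \<in> carrier A\<rbrakk> \<Longrightarrow> h x = h y \<longleftrightarrow> h (x \<ominus>\<^bsub>A\<^esub> y) = \<zero>\<^bsub>B\<^esub>"
  by (simp add: B.minus_eq_zero_iff)

lemma inj_onI: "(\<And>x. \<lbrakk>x \<in> carrier A; h x = \<zero>\<^bsub>B\<^esub>\<rbrakk> \<Longrightarrow> x = \<zero>\<^bsub>A\<^esub>) \<Longrightarrow> inj_on h (carrier A)"
  by (rule Fun.inj_onI) (metis A.minus_eq_zero_iff A.M.minus_closed eq_iff_minus)

end

lemma lie_homI:
  assumes "\<And>x. x \<in> carrier A \<Longrightarrow> h x \<in> carrier B"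
    and "\<And>x y. \<lbrakk>x \<in> carrier A; y \<in> carrier A\<rbrakk> \<Longrightarrow> h (x \<oplus>\<^bsub>A\<^esub> y) = h x \<oplus>\<^bsub>B\<^esub> h y"
    and "\<And>c x. \<lbrakk>c \<in> carrier K; x \<in> carrier A\<rbrakk> \<Longrightarrow> h (c \<odot>\<^bsub>A\<^esub> x) = c \<odot>\<^bsub>B\<^esub> h x"
    and "\<And>x y. \<lbrakk>x \<in> carrier A; y \<in> carrier A\<rbrakk> \<Longrightarrow> h (bracket A x y) = bracket B (h x) (h y)"
    and "\<And>x \<alpha>. x \<in> gr A \<alpha> \<Longrightarrow> h x \<in> gr B \<alpha>"
  shows "h \<in> lie_hom K A B"
  using assms by (auto simp: lie_hom_def module_hom_def)

lemma lie_homD: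
  assumes "h \<in> lie_hom K A B"
  shows "x \<in> carrier A \<Longrightarrow> h x \<in> carrier B"
    and "\<lbrakk>x \<in> carrier A; y \<in> carrier A\<rbrakk> \<Longrightarrow> h (x \<oplus>\<^bsub>A\<^esub> y) = h x \<oplus>\<^bsub>B\<^esub> h y"
    and "\<lbrakk>c \<in> carrier K; x \<in> carrier A\<rbrakk> \<Longrightarrow> h (c \<odot>\<^bsub>A\<^esub> x) = c \<odot>\<^bsub>B\<^esub> h x"
    and "\<lbrakk>x \<in> carrier A; y \<in> carrier A\<rbrakk> \<Longrightarrow> h (bracket A x y) = bracket B (h x) (h y)"
    and "x \<in> gr A \<alpha> \<Longrightarrow> h x \<in> gr B \<alpha>"
  using assms by (auto simp: lie_hom_def module_hom_def image_subset_iff)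

lemma lie_hom_comp:
  assumes "g \<in> lie_hom K A B" "h \<in> lie_hom K B C"
  shows "h \<circ> g \<in> lie_hom K A C"
  using assms by (intro lie_homI) (simp_all add: lie_homD)

lemma lie_hom_cong:
  assumes "lie_superalgebra K A" "g \<in> lie_hom K A B" and eq: "\<And>x. x \<in> carrier A \<Longrightarrow> h x = g x"
  shows "h \<in> lie_hom K A B"
proof -
  interpret A: lie_superalgebra K A by fact
  show ?thesis
    by (rule lie_homI) (simp_all add: eq lie_homD[OF assms(2)] A.bracket_closed A.gr_closed)
qed

text \<open>The map \<open>h\<close> is given and only its values on images under \<open>p\<close>
  are prescribed, so the lemma applies to explicit functions such as \<open>inv_into\<close> or
  \<open>the_elem\<close> of an image. Degrees are respected because homogeneous elements have
  homogeneous preimages.\<close>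

lemma lie_hom_factor:
  assumes "lie_superalgebra K A" "lie_superalgebra K B" "lie_superalgebra K C"
    and p: "p \<in> lie_hom K A B" "p ` carrier A = carrier B"
    and f: "f \<in> lie_hom K A C"
    and ker: "\<And>x. \<lbrakk>x \<in> carrier A; p x = \<zero>\<^bsub>B\<^esub>\<rbrakk> \<Longrightarrow> f x = \<zero>\<^bsub>C\<^esub>"
    and fac: "\<And>x. x \<in> carrier A \<Longrightarrow> h (p x) = f x"
  shows "h \<in> lie_hom K B C"
proof -
  interpret p: lie_morphism K A B p by (intro lie_morphism.intro lie_morphism_axioms.intro assms)
  interpret f: lie_morphism K A C f by (intro lie_morphism.intro lie_morphism_axioms.intro assms)
  have ex: "\<exists>x\<in>carrier A. b = p x" if "b \<in> carrier B" for b using p(2) that by auto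
  show ?thesis
  proof (rule lie_homI)
    fix b c assume "b \<in> carrier B" "c \<in> carrier B"
    then obtain x y where xy: "x \<in> carrier A" "y \<in> carrier A" "b = p x" "c = p y"
      using ex by metis
    then show "h b \<in> carrier C" by (simp add: fac)
    show "h (b \<oplus>\<^bsub>B\<^esub> c) = h b \<oplus>\<^bsub>C\<^esub> h c"
      using xy fac[of "x \<oplus>\<^bsub>A\<^esub> y"] by (simp add: fac)
    show "h (bracket B b c) = bracket C (h b) (h c)"
      using xy fac[of "bracket A x y"] by (simp add: fac p.A.bracket_closed)
  next
    fix c b assume "c \<in> carrier K" "b \<in> carrier B"
    then obtain x where x: "x \<in> carrier A" "b = p x" using ex by metis
    then show "h (c \<odot>\<^bsub>B\<^esub> b) = c \<odot>\<^bsub>C\<^esub> h b"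
      using fac[of "c \<odot>\<^bsub>A\<^esub> x"] \<open>c \<in> carrier K\<close> by (simp add: fac)
  next
    fix b \<alpha> assume "b \<in> gr B \<alpha>"
    then obtain x where "x \<in> gr A \<alpha>" "b = p x" using p.gr_surj[OF p(2), of \<alpha>] by blast
    then show "h b \<in> gr C \<alpha>" using f.gr by (simp add: fac p.A.gr_closed)
  qed
qed

lemma lie_hom_factor_exists:
  assumes "lie_superalgebra K A" "lie_superalgebra K B" "lie_superalgebra K C"
    and p: "p \<in> lie_hom K A B" "p ` carrier A = carrier B"
    and f: "f \<in> lie_hom K A C"
    and ker: "\<And>x. \<lbrakk>x \<in> carrier A; p x = \<zero>\<^bsub>B\<^esub>\<rbrakk> \<Longrightarrow> f x = \<zero>\<^bsub>C\<^esub>"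
  shows "\<exists>h\<in>lie_hom K B C. \<forall>x\<in>carrier A. h (p x) = f x"
proof -
  interpret p: lie_morphism K A B p by (intro lie_morphism.intro lie_morphism_axioms.intro assms)
  interpret f: lie_morphism K A C f by (intro lie_morphism.intro lie_morphism_axioms.intro assms)
  \<comment> \<open>Evaluate \<open>f\<close> at a chosen preimage; another preimage differs by an
    element of the kernel of \<open>p\<close>, on which \<open>f\<close> vanishes.\<close>
  define h where "h = f \<circ> inv_into (carrier A) p"
  have fac: "h (p x) = f x" if "x \<in> carrier A" for x
  proof -
    have y: "inv_into (carrier A) p (p x) \<in> carrier A" "p (inv_into (carrier A) p (p x)) = p x"
      using that by (auto intro: inv_into_into f_inv_into_f)
    then have "f (inv_into (carrier A) p (p x) \<ominus>\<^bsub>A\<^esub> x) = \<zero>\<^bsub>C\<^esub>"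
      using that p.eq_iff_minus ker p.A.M.minus_closed by metis
    then show ?thesis using f.eq_iff_minus[OF y(1) that] by (simp add: h_def)
  qed
  then show ?thesis using lie_hom_factor[OF assms] by blast
qed

text \<open>The inverse is the identity of \<open>A\<close> factored through
  \<open>h\<close>.\<close>

lemma lie_iso_inv:
  assumes "lie_superalgebra K A" "lie_superalgebra K B" and h: "h \<in> lie_iso K A B"
  shows "inv_into (carrier A) h \<in> lie_iso K B A"
proof -
  have bij: "bij_betw h (carrier A) (carrier B)" and hom: "h \<in> lie_hom K A B"
    using h by (auto simp: lie_iso_def)
  interpret h: lie_morphism K A B h by (intro lie_morphism.intro lie_morphism_axioms.intro assms hom)
  have "inv_into (carrier A) h \<in> lie_hom K B A"
  proof (rule lie_hom_factor[OF assms(1,2,1) hom])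
    show "h ` carrier A = carrier B" using bij by (simp add: bij_betw_def)
    show "(\<lambda>x. x) \<in> lie_hom K A A" by (rule lie_homI) auto
    show "inv_into (carrier A) h (h x) = x" if "x \<in> carrier A" for x
      using bij that by (simp add: bij_betw_inv_into_left)
    then show "x = \<zero>\<^bsub>A\<^esub>" if "x \<in> carrier A" "h x = \<zero>\<^bsub>B\<^esub>" for x
      using that by (metis h.A.M.zero_closed h.lin.f0_is_0)
  qed
  then show ?thesis using bij by (simp add: lie_iso_def bij_betw_inv_into)
qed

section \<open>Copies of a Lie superalgebra along an injection\<close>

text \<open>The universal property and maximality only test structures on fixed list types; this
  moves a structure there. The values of \<open>mult\<close> and \<open>one\<close> are
  placeholders.\<close>

definition transport :: "('f, 'v) superalgebra \<Rightarrow> ('v \<Rightarrow> 'w) \<Rightarrow> ('f, 'w) superalgebra" where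
  "transport A e = (let d = inv_into (carrier A) e in
     \<lparr>carrier = e ` carrier A, mult = \<lambda>X Y. e \<zero>\<^bsub>A\<^esub>, one = e \<zero>\<^bsub>A\<^esub>, zero = e \<zero>\<^bsub>A\<^esub>,
      add = \<lambda>X Y. e (d X \<oplus>\<^bsub>A\<^esub> d Y), smult = \<lambda>c X. e (c \<odot>\<^bsub>A\<^esub> d X),
      gr = \<lambda>\<alpha>. e ` gr A \<alpha>, bracket = \<lambda>X Y. e (bracket A (d X) (d Y))\<rparr>)"

lemma transport:
  assumes "lie_superalgebra K A" and inj: "inj_on e (carrier A)"
  shows "lie_superalgebra K (transport A e)" and "e \<in> lie_iso K A (transport A e)"
proof -
  interpret A: lie_superalgebra K A by fact
  have d: "inv_into (carrier A) e (e x) = x" if "x \<in> carrier A" for x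
    using inj that by (rule inv_into_f_f)
  show "lie_superalgebra K (transport A e)"
  proof (rule lie_superalgebra_image[OF assms(1)])
    fix x y assume xy: "x \<in> gr A 0" "y \<in> gr A 1" "e (x \<oplus>\<^bsub>A\<^esub> y) = \<zero>\<^bsub>transport A e\<^esub>"
    then have "x \<oplus>\<^bsub>A\<^esub> y = \<zero>\<^bsub>A\<^esub> \<oplus>\<^bsub>A\<^esub> \<zero>\<^bsub>A\<^esub>"
      using inj by (auto simp: transport_def Let_def inj_on_def)
    then have "x = \<zero>\<^bsub>A\<^esub>" using A.gr_decomp_unique(1)[OF xy(1,2) A.gr_zero A.gr_zero] by blast
    then show "e x = \<zero>\<^bsub>transport A e\<^esub>" by (simp add: transport_def Let_def)
  qed (simp_all add: transport_def Let_def d)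
  show "e \<in> lie_iso K A (transport A e)"
    unfolding lie_iso_def
  proof (intro CollectI conjI lie_homI)
    show "bij_betw e (carrier A) (carrier (transport A e))"
      using inj by (simp add: transport_def Let_def bij_betw_def)
  qed (simp_all add: transport_def Let_def d)
qed

section \<open>Graded subalgebras\<close>

lemma sub_superalgebra_sel:
  "carrier (sub_superalgebra A S) = S"
  "\<zero>\<^bsub>sub_superalgebra A S\<^esub> = \<zero>\<^bsub>A\<^esub>"
  "add (sub_superalgebra A S) = add A"
  "smult (sub_superalgebra A S) = smult A"
  "bracket (sub_superalgebra A S) = bracket A"
  "gr (sub_superalgebra A S) \<alpha> = gr A \<alpha> \<inter> S"
  by (simp_all add: sub_superalgebra_def)

lemma lie_superalgebra_sub:
  assumes "lie_superalgebra K A" and S: "graded_submodule K A S"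
    and br: "\<And>x y. \<lbrakk>x \<in> S; y \<in> S\<rbrakk> \<Longrightarrow> bracket A x y \<in> S"
  shows "lie_superalgebra K (sub_superalgebra A S)"
proof -
  interpret A: lie_superalgebra K A by fact
  interpret S: submodule K S A by (rule graded_submoduleD[OF S])
  let ?S = "sub_superalgebra A S"
  note sub [simp] = sub_superalgebra_sel[of A S]
  have [simp]: "\<And>x. x \<in> S \<Longrightarrow> x \<in> carrier A" using S.subset by auto
  interpret V: vectorspace K ?S
  proof (rule vectorspace_image)
    \<comment> \<open>The known subspace structure has the same carrier and operations as
      \<open>sub_superalgebra A S\<close>, so it is carried over along the identity.\<close>
    show "vectorspace K (A\<lparr>carrier := S\<rparr>)"
      by (rule A.subspace_is_vs) (intro subspace.intro A.vectorspace_axioms S.submodule_axioms)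
  qed (auto intro: image_ident)
  \<comment> \<open>Additive inverses are described relative to the carrier, so those of the
    subalgebra and of \<open>A\<close> are identified through multiplication by
    \<open>-1\<close>.\<close>
  have neg: "\<ominus>\<^bsub>?S\<^esub> x = \<ominus>\<^bsub>A\<^esub> x" if "x \<in> S" for x
    using V.smult_minus_1[of x] A.smult_minus_1[of x] that by simp
  have kz: "koszul ?S \<alpha> \<beta> x = koszul A \<alpha> \<beta> x" if "x \<in> S" for \<alpha> \<beta> x
    using that by (simp add: koszul_def neg)
  have kS: "koszul A \<alpha> \<beta> x \<in> S" if "x \<in> S" for \<alpha> \<beta> x
    using that A.submodule_neg[OF S.submodule_axioms] by (simp add: koszul_def)
  show ?thesis
  proof (intro lie_superalgebra.intro lie_superalgebra_axioms.intro V.vectorspace_axioms)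
    fix \<alpha>
    interpret G: submodule K "gr A \<alpha>" A by (rule A.gr_submodule)
    show "subspace K (gr ?S \<alpha>) ?S"
      by (intro subspace.intro V.vectorspace_axioms submodule.intro V.module_axioms) auto
  next
    show "gr ?S 0 \<inter> gr ?S 1 = {\<zero>\<^bsub>?S\<^esub>}" using A.gr_Int by auto
    show "gr ?S 0 <+>\<^bsub>?S\<^esub> gr ?S 1 = carrier ?S"
    proof
      show "gr ?S 0 <+>\<^bsub>?S\<^esub> gr ?S 1 \<subseteq> carrier ?S" by (auto simp: set_add_def')
      show "carrier ?S \<subseteq> gr ?S 0 <+>\<^bsub>?S\<^esub> gr ?S 1"
      proof
        fix x assume "x \<in> carrier ?S"
        then have x: "x \<in> S" by simp
        obtain x0 x1 where xx: "x0 \<in> gr A 0" "x1 \<in> gr A 1" "x = x0 \<oplus>\<^bsub>A\<^esub> x1"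
          using x A.gr_decomp S.subset by blast
        then have "x0 \<in> S" "x1 \<in> S" using graded_submoduleD(2,3)[OF S xx(1,2) x[unfolded xx(3)]] by auto
        then show "x \<in> gr ?S 0 <+>\<^bsub>?S\<^esub> gr ?S 1" using xx by (auto simp: set_add_def')
      qed
    qed
  next
    fix x y \<alpha> \<beta> assume "x \<in> gr ?S \<alpha>" "y \<in> gr ?S \<beta>"
    then have xy: "x \<in> gr A \<alpha>" "y \<in> gr A \<beta>" "x \<in> S" "y \<in> S" by simp_all
    then show "bracket ?S x y \<in> gr ?S (\<alpha> + \<beta>)" by (simp only: sub Int_iff br A.bracket_gr)
    show "bracket ?S x y = \<ominus>\<^bsub>?S\<^esub> koszul ?S \<alpha> \<beta> (bracket ?S y x)"
      using A.bracket_skew[OF xy(1,2)] xy(3,4) by (simp only: sub br kz kS neg)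
  next
    fix x y z \<alpha> \<beta> \<gamma> assume "x \<in> gr ?S \<alpha>" "y \<in> gr ?S \<beta>" "z \<in> gr ?S \<gamma>"
    then show "koszul ?S \<alpha> \<gamma> (bracket ?S x (bracket ?S y z))
        \<oplus>\<^bsub>?S\<^esub> koszul ?S \<beta> \<alpha> (bracket ?S y (bracket ?S z x))
        \<oplus>\<^bsub>?S\<^esub> koszul ?S \<gamma> \<beta> (bracket ?S z (bracket ?S x y)) = \<zero>\<^bsub>?S\<^esub>"
      using A.jacobi[of x \<alpha> y \<beta> z \<gamma>] by (simp add: br kz)
  qed (simp_all add: br A.bracket_add_left A.bracket_add_right A.bracket_smult_left A.bracket_smult_right)
qed

section \<open>Quotients by graded ideals\<close>

locale graded_ideal = lie_superalgebra K L for K :: "'f ring" and L :: "('f, 'v) superalgebra" +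
  fixes T :: "'v set"
  assumes graded: "graded_submodule K L T"
    and bracket_ideal_left: "\<lbrakk>x \<in> carrier L; t \<in> T\<rbrakk> \<Longrightarrow> bracket L x t \<in> T"
    and bracket_ideal_right: "\<lbrakk>x \<in> carrier L; t \<in> T\<rbrakk> \<Longrightarrow> bracket L t x \<in> T"
begin

sublocale T: submodule K T L
  by (rule graded_submoduleD[OF graded])

sublocale T: abelian_subgroup T L
  by (rule submodule_abelian_subgroup[OF T.submodule_axioms])

abbreviation Q where "Q \<equiv> quot_superalgebra L T"

lemma coset_eqI: "\<lbrakk>x \<in> carrier L; t \<in> T\<rbrakk> \<Longrightarrow> T +>\<^bsub>L\<^esub> (t \<oplus>\<^bsub>L\<^esub> x) = T +>\<^bsub>L\<^esub> x"
  using M.a_rcosI[of t T x] T.a_repr_independence'[of "t \<oplus>\<^bsub>L\<^esub> x" x] T.subset by simp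

lemma coset_eq_iff: "x \<in> carrier L \<Longrightarrow> T +>\<^bsub>L\<^esub> x = T \<longleftrightarrow> x \<in> T"
  using T.a_rcos_const T.a_rcos_self by blast

lemma coset_memE:
  assumes "y \<in> T +>\<^bsub>L\<^esub> x"
  obtains t where "t \<in> T" "y = t \<oplus>\<^bsub>L\<^esub> x"
  using assms unfolding a_r_coset_def' by blast

lemma quot_add: "\<lbrakk>x \<in> carrier L; y \<in> carrier L\<rbrakk> \<Longrightarrow>
    (T +>\<^bsub>L\<^esub> x) \<oplus>\<^bsub>Q\<^esub> (T +>\<^bsub>L\<^esub> y) = T +>\<^bsub>L\<^esub> (x \<oplus>\<^bsub>L\<^esub> y)"
  by (simp add: quot_superalgebra_def T.a_rcos_sum)

text \<open>The union defining the operation runs over representatives, and a change of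
  representative alters the product by an element of \<open>T\<close>. All cosets in the union
  therefore coincide.\<close>

lemma quot_smult:
  assumes "c \<in> carrier K" "x \<in> carrier L"
  shows "c \<odot>\<^bsub>Q\<^esub> (T +>\<^bsub>L\<^esub> x) = T +>\<^bsub>L\<^esub> (c \<odot>\<^bsub>L\<^esub> x)"
proof -
  have "T +>\<^bsub>L\<^esub> (c \<odot>\<^bsub>L\<^esub> y) = T +>\<^bsub>L\<^esub> (c \<odot>\<^bsub>L\<^esub> x)" if "y \<in> T +>\<^bsub>L\<^esub> x" for y
    using that
  proof (rule coset_memE)
    fix t assume "t \<in> T" "y = t \<oplus>\<^bsub>L\<^esub> x"
    then show ?thesis
      using assms by (simp add: smult_r_distr coset_eqI)
  qed
  moreover have "x \<in> T +>\<^bsub>L\<^esub> x" using assms T.a_rcos_self by blast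
  ultimately show ?thesis
    unfolding quot_superalgebra_def superalgebra.simps module.simps by (intro UN_constant_eq ballI)
qed

lemma quot_bracket:
  assumes "x \<in> carrier L" "y \<in> carrier L"
  shows "bracket Q (T +>\<^bsub>L\<^esub> x) (T +>\<^bsub>L\<^esub> y) = T +>\<^bsub>L\<^esub> bracket L x y"
proof -
  have "T +>\<^bsub>L\<^esub> bracket L x' y' = T +>\<^bsub>L\<^esub> bracket L x y"
    if "x' \<in> T +>\<^bsub>L\<^esub> x" "y' \<in> T +>\<^bsub>L\<^esub> y" for x' y'
  proof -
    obtain s t where st: "s \<in> T" "t \<in> T" "x' = s \<oplus>\<^bsub>L\<^esub> x" "y' = t \<oplus>\<^bsub>L\<^esub> y"
      using \<open>x' \<in> _\<close> \<open>y' \<in> _\<close> coset_memE by metis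
    \<comment> \<open>On the right, \<open>[s, t + y]\<close> and \<open>[x, t]\<close> lie in the
      ideal, which leaves the coset of \<open>[x, y]\<close>.\<close>
    then have "bracket L x' y' = bracket L s (t \<oplus>\<^bsub>L\<^esub> y) \<oplus>\<^bsub>L\<^esub> (bracket L x t \<oplus>\<^bsub>L\<^esub> bracket L x y)"
      using assms by (simp add: bracket_add_left[of s x] bracket_add_right[of x t])
    then show ?thesis
      using assms st by (simp add: coset_eqI bracket_ideal_left bracket_ideal_right bracket_closed)
  qed
  moreover have "x \<in> T +>\<^bsub>L\<^esub> x" "y \<in> T +>\<^bsub>L\<^esub> y" using assms T.a_rcos_self by blast+
  ultimately show ?thesis
    unfolding quot_superalgebra_def superalgebra.simps by (intro UN_constant_eq ballI)
qed

lemma quot_carrier: "(\<lambda>x. T +>\<^bsub>L\<^esub> x) ` carrier L = carrier Q"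
  by (auto simp: quot_superalgebra_def A_RCOSETS_def')

lemma quot_zero: "\<zero>\<^bsub>Q\<^esub> = T"
  by (simp add: quot_superalgebra_def)

lemma quot_gr: "gr Q \<alpha> = (\<lambda>x. T +>\<^bsub>L\<^esub> x) ` gr L \<alpha>"
  by (simp add: quot_superalgebra_def)

text \<open>The coset map is a surjection whose kernel \<open>T\<close> is graded, so
  \<open>lie_superalgebra_image\<close> applies.\<close>

lemma quot_lie_superalgebra: "lie_superalgebra K Q"
proof (rule lie_superalgebra_image[OF lie_superalgebra_axioms quot_carrier])
  fix x y assume xy: "x \<in> gr L 0" "y \<in> gr L 1" "T +>\<^bsub>L\<^esub> (x \<oplus>\<^bsub>L\<^esub> y) = \<zero>\<^bsub>Q\<^esub>"
  have "x \<oplus>\<^bsub>L\<^esub> y \<in> carrier L" using gr_closed[OF xy(1)] gr_closed[OF xy(2)] by (rule M.a_closed)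
  then have "x \<oplus>\<^bsub>L\<^esub> y \<in> T" using xy(3) by (simp only: quot_zero coset_eq_iff)
  then have "x \<in> T" by (rule graded_submoduleD(2)[OF graded xy(1,2)])
  then show "T +>\<^bsub>L\<^esub> x = \<zero>\<^bsub>Q\<^esub>" unfolding quot_zero by (rule T.a_rcos_const)
qed (simp_all add: quot_zero quot_add quot_smult quot_bracket quot_gr coset_eq_iff)

lemma quot_hom: "(\<lambda>x. T +>\<^bsub>L\<^esub> x) \<in> lie_hom K L Q"
  using quot_carrier by (intro lie_homI) (auto simp: quot_add quot_smult quot_bracket quot_gr)

end

section \<open>Commutators and stem extensions\<close>

lemma (in module) submodule_sum_iff:
  "x \<in> submodule_sum N1 N2 \<longleftrightarrow> (\<exists>a\<in>N1. \<exists>b\<in>N2. x = a \<oplus>\<^bsub>M\<^esub> b)"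
  unfolding submodule_sum_def by auto

lemma (in module) submodule_Int: "\<lbrakk>submodule R N M; submodule R N' M\<rbrakk> \<Longrightarrow> submodule R (N \<inter> N') M"
  unfolding submodule_def by blast

lemma (in mod_hom) vimage_submodule:
  assumes "submodule R S N"
  shows "submodule R {x \<in> carrier M. f x \<in> S} M"
proof -
  interpret S: submodule R S N by fact
  show ?thesis by unfold_locales auto
qed

lemma (in mod_hom) image_submodule:
  assumes "submodule R S M"
  shows "submodule R (f ` S) N"
proof -
  interpret S: submodule R S M by fact
  have c: "x \<in> carrier M" if "x \<in> S" for x using that S.subset by blast
  show ?thesis
  proof unfold_locales
    show "f ` S \<subseteq> carrier N" using c by auto
    show "\<zero>\<^bsub>N\<^esub> \<in> f ` S" by (rule image_eqI[of _ _ "\<zero>\<^bsub>M\<^esub>"]) simp_all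
    fix v w assume "v \<in> f ` S" "w \<in> f ` S"
    then obtain x y where "x \<in> S" "y \<in> S" "v = f x" "w = f y" by blast
    then show "v \<oplus>\<^bsub>N\<^esub> w \<in> f ` S" using c by (intro image_eqI[of _ _ "x \<oplus>\<^bsub>M\<^esub> y"]) simp_all
  next
    fix k v assume "k \<in> carrier R" "v \<in> f ` S"
    then obtain x where "x \<in> S" "v = f x" by blast
    then show "k \<odot>\<^bsub>N\<^esub> v \<in> f ` S"
      using c \<open>k \<in> carrier R\<close> by (intro image_eqI[of _ _ "k \<odot>\<^bsub>M\<^esub> x"]) simp_all
  qed
qed

context lie_superalgebra
begin

lemma graded_submoduleI:
  assumes "submodule K S L"
    and dec: "\<And>x. x \<in> S \<Longrightarrow> \<exists>a\<in>S \<inter> gr L 0. \<exists>b\<in>S \<inter> gr L 1. x = a \<oplus>\<^bsub>L\<^esub> b"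
  shows "graded_submodule K L S"
  unfolding graded_submodule_def
proof (intro conjI ballI impI assms(1))
  fix x y assume xy: "x \<in> gr L 0" "y \<in> gr L 1" "x \<oplus>\<^bsub>L\<^esub> y \<in> S"
  obtain a b where ab: "a \<in> S" "a \<in> gr L 0" "b \<in> S" "b \<in> gr L 1" "x \<oplus>\<^bsub>L\<^esub> y = a \<oplus>\<^bsub>L\<^esub> b"
    using dec[OF xy(3)] by blast
  show "x \<in> S" "y \<in> S" using gr_decomp_unique[OF xy(1,2) ab(2,4,5)] ab(1,3) by simp_all
qed

lemma graded_submodule_decomp:
  assumes "graded_submodule K L S" "x \<in> S"
  obtains a b where "a \<in> S" "b \<in> S" "a \<in> gr L 0" "b \<in> gr L 1" "x = a \<oplus>\<^bsub>L\<^esub> b"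
proof -
  have "x \<in> carrier L" using submodule.subset[OF graded_submoduleD(1)[OF assms(1)]] assms(2) by blast
  then obtain a b where ab: "a \<in> gr L 0" "b \<in> gr L 1" "x = a \<oplus>\<^bsub>L\<^esub> b" by (rule gr_decomp)
  show ?thesis
    using that graded_submoduleD(2,3)[OF assms(1) ab(1,2)] ab assms(2) by simp
qed

lemma carrier_graded: "graded_submodule K L (carrier L)"
proof -
  have "submodule K (carrier L) L" by unfold_locales auto
  then show ?thesis by (simp add: graded_submodule_def)
qed

context
  fixes I J assumes IJ: "I \<subseteq> carrier L" "J \<subseteq> carrier L"
begin

lemma commutator_submodule: "submodule K (commutator K L I J) L"
  unfolding commutator_def using IJ bracket_closed by (intro span_is_submodule) blast

lemma commutatorI: "\<lbrakk>x \<in> I; y \<in> J\<rbrakk> \<Longrightarrow> bracket L x y \<in> commutator K L I J"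
  unfolding commutator_def
  by (rule subsetD[OF in_own_span]) (use IJ bracket_closed in blast)+

lemma commutator_subset:
  assumes "submodule K N L" "\<And>x y. \<lbrakk>x \<in> I; y \<in> J\<rbrakk> \<Longrightarrow> bracket L x y \<in> N"
  shows "commutator K L I J \<subseteq> N"
  unfolding commutator_def by (rule span_is_subset[OF _ assms(1)]) (use assms(2) in blast)

text \<open>A bracket of \<open>a + b\<close> and \<open>c + d\<close>, split by degree, has even
  part \<open>[a,c] + [b,d]\<close> and odd part \<open>[a,d] + [b,c]\<close>. Both parts stay in
  the commutator because \<open>I\<close> and \<open>J\<close> contain the components of their
  elements.\<close>

lemma commutator_graded:
  assumes "graded_submodule K L I" "graded_submodule K L J"
  shows "graded_submodule K L (commutator K L I J)"
proof (rule graded_submoduleI[OF commutator_submodule])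
  let ?C = "commutator K L I J"
  let ?N = "submodule_sum (?C \<inter> gr L 0) (?C \<inter> gr L 1)"
  have "?C \<subseteq> ?N"
  proof (rule commutator_subset)
    show "submodule K ?N L"
      by (intro sum_is_submodule submodule_Int commutator_submodule gr_submodule)
    fix x y assume "x \<in> I" "y \<in> J"
    obtain a b where x: "a \<in> I" "b \<in> I" "a \<in> gr L 0" "b \<in> gr L 1" "x = a \<oplus>\<^bsub>L\<^esub> b"
      using graded_submodule_decomp[OF assms(1) \<open>x \<in> I\<close>] .
    obtain c d where y: "c \<in> J" "d \<in> J" "c \<in> gr L 0" "d \<in> gr L 1" "y = c \<oplus>\<^bsub>L\<^esub> d"
      using graded_submodule_decomp[OF assms(2) \<open>y \<in> J\<close>] .
    have car: "a \<in> carrier L" "b \<in> carrier L" "c \<in> carrier L" "d \<in> carrier L"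
      using x(3,4) y(3,4) gr_closed by blast+
    have "bracket L x y = (bracket L a c \<oplus>\<^bsub>L\<^esub> bracket L b d) \<oplus>\<^bsub>L\<^esub> (bracket L a d \<oplus>\<^bsub>L\<^esub> bracket L b c)"
      using car by (simp add: x(5) y(5) bracket_add_left bracket_add_right bracket_closed M.a_ac)
    moreover have "bracket L a c \<oplus>\<^bsub>L\<^esub> bracket L b d \<in> ?C \<inter> gr L 0"
      using bracket_gr[OF x(3) y(3)] bracket_gr[OF x(4) y(4)]
      by (auto intro!: gr_add submodule.m_closed[OF commutator_submodule] commutatorI x y)
    moreover have "bracket L a d \<oplus>\<^bsub>L\<^esub> bracket L b c \<in> ?C \<inter> gr L 1"
      using bracket_gr[OF x(3) y(4)] bracket_gr[OF x(4) y(3)]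
      by (auto intro!: gr_add submodule.m_closed[OF commutator_submodule] commutatorI x y)
    ultimately show "bracket L x y \<in> ?N"
      unfolding submodule_sum_iff by blast
  qed
  then show "\<exists>a\<in>?C \<inter> gr L 0. \<exists>b\<in>?C \<inter> gr L 1. x = a \<oplus>\<^bsub>L\<^esub> b" if "x \<in> ?C" for x
    using that unfolding submodule_sum_iff[symmetric] by (rule subsetD)
qed

end

lemmas derived_submodule = commutator_submodule[OF subset_refl subset_refl]
lemmas derivedI = commutatorI[OF subset_refl subset_refl]
lemmas derived_graded = commutator_graded[OF subset_refl subset_refl carrier_graded carrier_graded]

lemma derived_closed: "x \<in> derived K L \<Longrightarrow> x \<in> carrier L"
  using submodule.subset[OF derived_submodule] by blast

text \<open>Only the left bracket occurs in \<^const>\<open>lie_center\<close>. Comparing degrees, both homogeneous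
  components of a central element are central, so skew symmetry applies to them.\<close>

lemma center_right:
  assumes "z \<in> lie_center L" "x \<in> carrier L"
  shows "bracket L x z = \<zero>\<^bsub>L\<^esub>"
proof -
  have z: "z \<in> carrier L" "\<And>x. x \<in> carrier L \<Longrightarrow> bracket L z x = \<zero>\<^bsub>L\<^esub>"
    using assms(1) by (auto simp: lie_center_def)
  obtain a b where ab: "a \<in> gr L 0" "b \<in> gr L 1" "z = a \<oplus>\<^bsub>L\<^esub> b" using gr_decomp[OF z(1)] .
  note c = gr_closed[OF ab(1)] gr_closed[OF ab(2)]
  have hom: "bracket L x z = \<zero>\<^bsub>L\<^esub>" if x: "x \<in> gr L \<alpha>" for x \<alpha>
  proof -
    note xc = gr_closed[OF x]
    have s: "bracket L a x \<oplus>\<^bsub>L\<^esub> bracket L b x = \<zero>\<^bsub>L\<^esub>"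
      using z(2)[OF xc] c xc by (simp add: ab(3) bracket_add_left)
    have g: "bracket L a x \<in> gr L \<alpha>" "bracket L b x \<in> gr L (1 + \<alpha>)"
      using bracket_gr[OF ab(1) x] bracket_gr[OF ab(2) x] by (simp_all only: add_0_left)
    have "bracket L a x = \<zero>\<^bsub>L\<^esub> \<and> bracket L b x = \<zero>\<^bsub>L\<^esub>"
    proof (cases "\<alpha> = 0")
      case True
      then show ?thesis
        using gr_decomp_unique[of "bracket L a x" "bracket L b x" "\<zero>\<^bsub>L\<^esub>" "\<zero>\<^bsub>L\<^esub>"] g s by simp
    next
      case False
      have "bracket L b x \<oplus>\<^bsub>L\<^esub> bracket L a x = \<zero>\<^bsub>L\<^esub> \<oplus>\<^bsub>L\<^esub> \<zero>\<^bsub>L\<^esub>"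
        using s c xc by (simp add: M.a_comm bracket_closed)
      then show ?thesis
        using gr_decomp_unique[of "bracket L b x" "bracket L a x" "\<zero>\<^bsub>L\<^esub>" "\<zero>\<^bsub>L\<^esub>"] g False by simp
    qed
    then have "bracket L x a = \<zero>\<^bsub>L\<^esub>" "bracket L x b = \<zero>\<^bsub>L\<^esub>"
      using bracket_skew[OF x ab(1)] bracket_skew[OF x ab(2)] by (simp_all add: koszul_def)
    then show ?thesis using c xc by (simp add: ab(3) bracket_add_right)
  qed
  obtain p q where pq: "p \<in> gr L 0" "q \<in> gr L 1" "x = p \<oplus>\<^bsub>L\<^esub> q" using gr_decomp[OF assms(2)] .
  then show ?thesis using hom[OF pq(1)] hom[OF pq(2)] z(1) by (simp add: bracket_add_left)
qed

text \<open>Brackets depend on their arguments only modulo the centre. In a stem extension they are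
  therefore determined by the images of the arguments in the base algebra.\<close>

lemma bracket_add_center:
  assumes "x \<in> carrier L" "y \<in> carrier L" "z \<in> lie_center L" "w \<in> lie_center L"
  shows "bracket L (x \<oplus>\<^bsub>L\<^esub> z) (y \<oplus>\<^bsub>L\<^esub> w) = bracket L x y"
proof -
  have "z \<in> carrier L" "w \<in> carrier L" "\<And>u. u \<in> carrier L \<Longrightarrow> bracket L z u = \<zero>\<^bsub>L\<^esub>"
    using assms by (auto simp: lie_center_def)
  then show ?thesis
    using assms by (simp add: bracket_add_left bracket_add_right bracket_closed center_right)
qed

end

context lie_morphism
begin

lemma ker_ideal: "graded_ideal K A (a_kernel A B h)"
  by (intro graded_ideal.intro graded_ideal_axioms.intro A.lie_superalgebra_axioms ker_graded)
    (auto simp: a_kernel_def' A.bracket_closed)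

lemma derived_image: "x \<in> derived K A \<Longrightarrow> h x \<in> derived K B"
proof -
  have "derived K A \<subseteq> {x \<in> carrier A. h x \<in> derived K B}"
    by (rule A.commutator_subset) (auto intro!: lin.vimage_submodule B.derived_submodule B.derivedI A.bracket_closed)
  then show "x \<in> derived K A \<Longrightarrow> h x \<in> derived K B" by blast
qed

end

lemma lie_extensionD:
  assumes "lie_extension K L A f"
  shows "lie_morphism K A L f" "f ` carrier A = carrier L"
  using assms by (auto simp: lie_extension_def intro!: lie_morphism.intro lie_morphism_axioms.intro)

lemma stem_extensionD:
  assumes "stem_extension K L A f"
  shows "lie_extension K L A f"
    and "\<lbrakk>x \<in> carrier A; f x = \<zero>\<^bsub>L\<^esub>\<rbrakk> \<Longrightarrow> x \<in> lie_center A"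
    and "\<lbrakk>x \<in> carrier A; f x = \<zero>\<^bsub>L\<^esub>\<rbrakk> \<Longrightarrow> x \<in> derived K A"
  using assms by (auto simp: stem_extension_def a_kernel_def')

text \<open>The kernel of \<open>f'\<close> is the image under \<open>p\<close> of the kernel of
  \<open>f\<close>. The last two assumptions are exactly centrality and containment in the derived
  algebra, read off in \<open>A\<close>.\<close>

lemma stem_extension_image:
  assumes ext: "lie_extension K L A f" and B: "lie_superalgebra K B"
    and p: "p \<in> lie_hom K A B" "p ` carrier A = carrier B"
    and f': "f' \<in> lie_hom K B L" "\<And>x. x \<in> carrier A \<Longrightarrow> f' (p x) = f x"
    and central: "\<And>r x. \<lbrakk>r \<in> a_kernel A L f; x \<in> carrier A\<rbrakk> \<Longrightarrow> p (bracket A r x) = \<zero>\<^bsub>B\<^esub>"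
    and stem: "\<And>r. r \<in> a_kernel A L f \<Longrightarrow> \<exists>d\<in>derived K A. p r = p d"
  shows "stem_extension K L B f'"
proof -
  interpret f: lie_morphism K A L f by (rule lie_extensionD[OF ext])
  interpret p: lie_morphism K A B p
    by (intro lie_morphism.intro lie_morphism_axioms.intro f.A.lie_superalgebra_axioms B p)
  have "f' ` carrier B = carrier L"
    using lie_extensionD(2)[OF ext] f'(2) by (simp add: p(2)[symmetric] image_image)
  moreover have "b \<in> lie_center B \<inter> derived K B" if b: "b \<in> a_kernel B L f'" for b
  proof -
    have "b \<in> p ` carrier A" using b unfolding p(2) by (simp add: a_kernel_def')
    then obtain r where r: "r \<in> carrier A" "b = p r" by blast
    then have rk: "r \<in> a_kernel A L f" using b f'(2) by (simp add: a_kernel_def')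
    have "bracket B b c = \<zero>\<^bsub>B\<^esub>" if c: "c \<in> carrier B" for c
    proof -
      obtain x where "x \<in> carrier A" "c = p x" using c unfolding p(2)[symmetric] by blast
      then show ?thesis using central[OF rk] r by simp
    qed
    moreover have "b \<in> derived K B" using stem[OF rk] p.derived_image r by auto
    ultimately show ?thesis using r by (simp add: lie_center_def)
  qed
  ultimately show ?thesis
    using f' B f.B.lie_superalgebra_axioms by (auto simp: stem_extension_def lie_extension_def)
qed

section \<open>Coding the elements of a stem extension by words\<close>

fun word_value :: "('f, 'a) superalgebra \<Rightarrow> ('l \<Rightarrow> 'a) \<Rightarrow> 'l list \<Rightarrow> 'a" where
  "word_value A s [] = \<zero>\<^bsub>A\<^esub>"
| "word_value A s [x] = s x"
| "word_value A s (x # y # w) = bracket A (s x) (s y) \<oplus>\<^bsub>A\<^esub> word_value A s w"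

lemma (in lie_superalgebra) word_value_closed:
  "\<lbrakk>w \<in> lists X; \<And>x. x \<in> X \<Longrightarrow> s x \<in> carrier L\<rbrakk> \<Longrightarrow> word_value L s w \<in> carrier L"
  by (induction w rule: induct_list012) (simp_all add: bracket_closed)

text \<open>Even length of the first word keeps the letters of the second one paired as
  before.\<close>

lemma (in lie_superalgebra) word_value_append:
  "\<lbrakk>even (length u); u \<in> lists X; w \<in> lists X; \<And>x. x \<in> X \<Longrightarrow> s x \<in> carrier L\<rbrakk> \<Longrightarrow>
     word_value L s (u @ w) = word_value L s u \<oplus>\<^bsub>L\<^esub> word_value L s w"
  by (induction u rule: induct_list012)
    (simp_all add: bracket_closed M.a_assoc word_value_closed[where X=X])

text \<open>An element differs from the chosen representative of its image by a kernel element. The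
  latter is a sum of brackets, and these may be taken between representatives. Hence words over
  \<open>L\<close> reach all of \<open>A\<close>, and choosing a word for each element is
  injective.\<close>

lemma stem_extension_code:
  assumes "stem_extension K L A f"
  obtains e where "inj_on e (carrier A)" "e ` carrier A \<subseteq> lists (carrier L)"
proof -
  note stem = stem_extensionD[OF assms]
  interpret f: lie_morphism K A L f by (rule lie_extensionD[OF stem(1)])
  note surj = lie_extensionD(2)[OF stem(1)]
  define s where "s = inv_into (carrier A) f"
  have s: "s x \<in> carrier A" "f (s x) = x" if "x \<in> carrier L" for x
    using that surj by (auto simp: s_def inv_into_into f_inv_into_f)
  have dec: "\<exists>z\<in>lie_center A. z \<in> derived K A \<and> x = s (f x) \<oplus>\<^bsub>A\<^esub> z" if x: "x \<in> carrier A" for x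
  proof (intro bexI conjI)
    have sx: "s (f x) \<in> carrier A" "f (s (f x)) = f x" using s x by auto
    show "x = s (f x) \<oplus>\<^bsub>A\<^esub> (x \<ominus>\<^bsub>A\<^esub> s (f x))"
      using sx x by (simp add: a_minus_def f.A.M.a_lcomm f.A.M.r_neg)
    have "f (x \<ominus>\<^bsub>A\<^esub> s (f x)) = \<zero>\<^bsub>L\<^esub>" using sx x by simp
    then show "x \<ominus>\<^bsub>A\<^esub> s (f x) \<in> lie_center A" "x \<ominus>\<^bsub>A\<^esub> s (f x) \<in> derived K A"
      using stem(2,3) sx x by simp_all
  qed
  have br: "bracket A x y = bracket A (s (f x)) (s (f y))" if "x \<in> carrier A" "y \<in> carrier A" for x y
  proof -
    obtain z w where zw: "z \<in> lie_center A" "x = s (f x) \<oplus>\<^bsub>A\<^esub> z" "w \<in> lie_center A" "y = s (f y) \<oplus>\<^bsub>A\<^esub> w"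
      using dec \<open>x \<in> carrier A\<close> \<open>y \<in> carrier A\<close> by metis
    have "s (f x) \<in> carrier A" "s (f y) \<in> carrier A" using s that by auto
    then have "bracket A (s (f x) \<oplus>\<^bsub>A\<^esub> z) (s (f y) \<oplus>\<^bsub>A\<^esub> w) = bracket A (s (f x)) (s (f y))"
      by (rule f.A.bracket_add_center[OF _ _ zw(1,3)])
    then show ?thesis using zw(2,4) by simp
  qed
  \<comment> \<open>Words without an unpaired last letter have sums of brackets as values; their
    values will be shown to exhaust the derived algebra.\<close>
  define W where "W = {w \<in> lists (carrier L). even (length w)}"
  have W: "w \<in> lists (carrier L)" "even (length w)" if "w \<in> W" for w using that by (auto simp: W_def)
  let ?v = "word_value A s"
  have app: "?v (u @ w) = ?v u \<oplus>\<^bsub>A\<^esub> ?v w" if "u \<in> W" "w \<in> lists (carrier L)" for u w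
    using W[OF that(1)] that(2) s(1) by (intro f.A.word_value_append[where X="carrier L"])
  have cl: "?v w \<in> carrier A" if "w \<in> lists (carrier L)" for w
    using that s(1) by (rule f.A.word_value_closed)
  have brW: "bracket A x y \<in> ?v ` W" if "x \<in> carrier A" "y \<in> carrier A" for x y
    using br[OF that] that s
    by (intro image_eqI[of _ _ "[f x, f y]"]) (simp_all add: W_def f.A.bracket_closed)
  have addW: "a \<oplus>\<^bsub>A\<^esub> b \<in> ?v ` W" if ab: "a \<in> ?v ` W" "b \<in> ?v ` W" for a b
  proof -
    obtain u w where uw: "u \<in> W" "w \<in> W" "a = ?v u" "b = ?v w" using ab by blast
    then have "a \<oplus>\<^bsub>A\<^esub> b = ?v (u @ w)" using app[OF uw(1) W(1)[OF uw(2)]] by simp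
    moreover have "u @ w \<in> W" using uw(1,2) by (simp add: W_def)
    ultimately show ?thesis by (rule image_eqI)
  qed
  \<comment> \<open>The scalar is absorbed into the left entry of the first bracket. The vector
    \<open>c s(x)\<close> need not be a chosen representative, but by \<open>brW\<close> its bracket
    is still the value of a word in \<open>W\<close>.\<close>
  have smW: "c \<odot>\<^bsub>A\<^esub> ?v w \<in> ?v ` W" if c: "c \<in> carrier K" and "w \<in> W" for c w
    using \<open>w \<in> W\<close>
  proof (induction "length w" arbitrary: w rule: less_induct)
    case less
    show ?case
    proof (cases w)
      case Nil
      then show ?thesis using c by (intro image_eqI[of _ _ "[]"]) (simp_all add: W_def)
    next
      case (Cons x w')
      then obtain y u where w: "w = x # y # u"
        using W(2)[OF less.prems] by (cases w') auto
      have u: "u \<in> W" "x \<in> carrier L" "y \<in> carrier L" using less.prems by (auto simp: w W_def)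
      then have "c \<odot>\<^bsub>A\<^esub> ?v w = bracket A (c \<odot>\<^bsub>A\<^esub> s x) (s y) \<oplus>\<^bsub>A\<^esub> c \<odot>\<^bsub>A\<^esub> ?v u"
        using c s cl[OF W(1)]
        by (simp add: w f.A.smult_r_distr f.A.bracket_closed f.A.bracket_smult_left)
      moreover have "c \<odot>\<^bsub>A\<^esub> ?v u \<in> ?v ` W" using less.hyps u(1) by (simp add: w)
      ultimately show ?thesis using addW brW c s u by simp
    qed
  qed
  have "submodule K (?v ` W) A"
  proof unfold_locales
    show "?v ` W \<subseteq> carrier A" using cl W by blast
    show "\<zero>\<^bsub>A\<^esub> \<in> ?v ` W" by (intro image_eqI[of _ _ "[]"]) (simp_all add: W_def)
  qed (use addW smW in auto)
  then have der: "derived K A \<subseteq> ?v ` W"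
    by (rule f.A.commutator_subset[OF subset_refl subset_refl _ brW])
  have onto: "carrier A \<subseteq> ?v ` lists (carrier L)"
  proof
    fix x assume x: "x \<in> carrier A"
    obtain z where z: "z \<in> derived K A" "x = s (f x) \<oplus>\<^bsub>A\<^esub> z" using dec[OF x] by blast
    then obtain w where w: "w \<in> W" "z = ?v w" using der by blast
    \<comment> \<open>The even word accounts for the kernel element, the unpaired last letter for
      the representative of \<open>f x\<close>.\<close>
    have "?v (w @ [f x]) = z \<oplus>\<^bsub>A\<^esub> s (f x)" using w x by (simp add: app)
    also have "\<dots> = x" using z x s f.A.derived_closed[OF z(1)] by (simp add: f.A.M.a_comm)
    finally show "x \<in> ?v ` lists (carrier L)"
      using W(1)[OF w(1)] x by (intro image_eqI[of _ _ "w @ [f x]"]) simp_all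
  qed
  show ?thesis
  proof (rule that)
    show "inj_on (inv_into (lists (carrier L)) ?v) (carrier A)" using onto by (rule inj_on_inv_into)
    show "inv_into (lists (carrier L)) ?v ` carrier A \<subseteq> lists (carrier L)"
      by (intro image_subsetI inv_into_into) (rule subsetD[OF onto])
  qed
qed

section \<open>Lifting through a free presentation\<close>

lemma a_kernelI: "\<lbrakk>x \<in> carrier G; h x = \<zero>\<^bsub>H\<^esub>\<rbrakk> \<Longrightarrow> x \<in> a_kernel G H h"
  and a_kernelD: "x \<in> a_kernel G H h \<Longrightarrow> x \<in> carrier G" "x \<in> a_kernel G H h \<Longrightarrow> h x = \<zero>\<^bsub>H\<^esub>"
  by (simp_all add: a_kernel_def')

text \<open>The generators of the commutator have their entry from \<open>R\<close> on the right.
  Skew symmetry exchanges the entries only for homogeneous arguments, so both are decomposed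
  first.\<close>

lemma (in lie_superalgebra) commutator_swap:
  assumes R: "graded_submodule K L R" and r: "r \<in> R" and x: "x \<in> carrier L"
  shows "bracket L r x \<in> commutator K L (carrier L) R"
proof -
  let ?C = "commutator K L (carrier L) R"
  have sub: "R \<subseteq> carrier L" using submodule.subset[OF graded_submoduleD(1)[OF R]] .
  note C = commutator_submodule[OF subset_refl sub] and CI = commutatorI[OF subset_refl sub]
  have hom: "bracket L u v \<in> ?C" if "u \<in> R" "u \<in> gr L \<alpha>" "v \<in> gr L \<beta>" for u v \<alpha> \<beta>
  proof -
    have "bracket L v u \<in> ?C" using that by (intro CI) simp_all
    then have "\<ominus>\<^bsub>L\<^esub> koszul L \<alpha> \<beta> (bracket L v u) \<in> ?C"
      using submodule_neg[OF C] by (simp add: koszul_def)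
    then show ?thesis using bracket_skew[OF that(2,3)] by simp
  qed
  obtain a b where r': "a \<in> R" "b \<in> R" "a \<in> gr L 0" "b \<in> gr L 1" "r = a \<oplus>\<^bsub>L\<^esub> b"
    using graded_submodule_decomp[OF R r] .
  obtain c d where x': "c \<in> gr L 0" "d \<in> gr L 1" "x = c \<oplus>\<^bsub>L\<^esub> d" using gr_decomp[OF x] .
  have car: "a \<in> carrier L" "b \<in> carrier L" "c \<in> carrier L" "d \<in> carrier L"
    using gr_closed[OF r'(3)] gr_closed[OF r'(4)] gr_closed[OF x'(1)] gr_closed[OF x'(2)] .
  then have "bracket L r x =
      (bracket L a c \<oplus>\<^bsub>L\<^esub> bracket L a d) \<oplus>\<^bsub>L\<^esub> (bracket L b c \<oplus>\<^bsub>L\<^esub> bracket L b d)"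
    by (simp add: r'(5) x'(3) bracket_add_left bracket_add_right bracket_closed M.a_ac)
  then show ?thesis
    using hom[OF r'(1,3) x'(1)] hom[OF r'(1,3) x'(2)] hom[OF r'(2,4) x'(1)] hom[OF r'(2,4) x'(2)]
    by (simp add: submodule.m_closed[OF C])
qed

context graded_ideal
begin

text \<open>Bracketing an element of \<open>S\<close> with anything lands in \<open>[L, T]\<close>,
  hence back in \<open>S\<close>. This yields both the ideal \<open>[F, R]\<close> and the quotients
  of \<open>F\<close> by graded subspaces between \<open>[F, R]\<close> and
  \<open>R\<close>.\<close>

lemma graded_ideal_between:
  assumes "graded_submodule K L S" "commutator K L (carrier L) T \<subseteq> S" "S \<subseteq> T"
  shows "graded_ideal K L S"
proof (intro graded_ideal.intro graded_ideal_axioms.intro lie_superalgebra_axioms assms(1))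
  fix x t assume xt: "x \<in> carrier L" "t \<in> S"
  then have "t \<in> T" using assms(3) by blast
  then show "bracket L x t \<in> S" "bracket L t x \<in> S"
    using commutatorI[OF subset_refl T.subset] commutator_swap[OF graded] xt(1) assms(2) by blast+
qed

lemma commutator_ideal_subset: "commutator K L (carrier L) T \<subseteq> T"
  by (rule commutator_subset[OF subset_refl T.subset T.submodule_axioms bracket_ideal_left])

lemma commutator_ideal: "graded_ideal K L (commutator K L (carrier L) T)"
  using commutator_graded[OF subset_refl T.subset carrier_graded graded] commutator_ideal_subset
  by (intro graded_ideal_between) simp_all

text \<open>The multiplier is a quotient of a subalgebra, so the ideal property has to be available
  inside the subalgebra record.\<close>

lemma graded_ideal_sub:
  assumes S: "graded_submodule K L S" "\<And>x y. \<lbrakk>x \<in> S; y \<in> S\<rbrakk> \<Longrightarrow> bracket L x y \<in> S" and "T \<subseteq> S"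
  shows "graded_ideal K (sub_superalgebra L S) T"
proof -
  let ?S = "sub_superalgebra L S"
  interpret S: lie_superalgebra K ?S by (rule lie_superalgebra_sub[OF lie_superalgebra_axioms S])
  have SL: "S \<subseteq> carrier L" using submodule.subset[OF graded_submoduleD(1)[OF S(1)]] .
  have "submodule K T ?S"
    by (intro submodule.intro S.module_axioms) (use \<open>T \<subseteq> S\<close> in \<open>auto simp: sub_superalgebra_sel\<close>)
  then have "graded_submodule K ?S T"
    using graded by (auto simp: graded_submodule_def sub_superalgebra_sel)
  then show ?thesis
    using SL by (intro graded_ideal.intro graded_ideal_axioms.intro S.lie_superalgebra_axioms)
      (auto simp: sub_superalgebra_sel intro: bracket_ideal_left bracket_ideal_right)
qed

end

section \<open>Free presentations and lifts to stem extensions\<close>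

locale lie_free_presentation =
  fixes K :: "'f ring" and L :: "('f, 'l) superalgebra"
    and X :: "bit \<Rightarrow> 'x set" and i :: "'x \<Rightarrow> 'p"
    and F :: "('f, 'p) superalgebra" and \<pi> :: "'p \<Rightarrow> 'l"
  assumes pres: "free_presentation K L X i F \<pi>"
begin

lemma free: "free_lie_superalgebra K X i F" and ext: "lie_extension K L F \<pi>"
  using pres by (simp_all add: free_presentation_def)

sublocale \<pi>: lie_morphism K F L \<pi>
  by (rule lie_extensionD(1)[OF ext])

lemma \<pi>_surj: "\<pi> ` carrier F = carrier L"
  by (rule lie_extensionD(2)[OF ext])

lemma gen_gr: "x \<in> X \<alpha> \<Longrightarrow> i x \<in> gr F \<alpha>"
  using free by (auto simp: free_lie_superalgebra_def)

lemma gen_disjoint: "X 0 \<inter> X 1 = {}"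
  using free by (simp add: free_lie_superalgebra_def)

lemma free_universal:
  fixes N :: "('f, ('x + 'f + 'p) list) superalgebra"
  assumes "lie_superalgebra K N" "\<And>x \<alpha>. x \<in> X \<alpha> \<Longrightarrow> j x \<in> gr N \<alpha>"
  shows "\<exists>!h. h \<in> lie_hom K F N \<and> h \<in> extensional (carrier F) \<and> (\<forall>\<alpha>. \<forall>x\<in>X \<alpha>. h (i x) = j x)"
proof -
  have "\<forall>(N :: ('f, ('x + 'f + 'p) list) superalgebra) j.
      lie_superalgebra K N \<and> (\<forall>\<alpha>. j ` X \<alpha> \<subseteq> gr N \<alpha>) \<longrightarrow>
      (\<exists>!h. h \<in> lie_hom K F N \<and> h \<in> extensional (carrier F) \<and> (\<forall>\<alpha>. \<forall>x\<in>X \<alpha>. h (i x) = j x))"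
    using free unfolding free_lie_superalgebra_def by (elim conjE)
  then show ?thesis using assms by (simp add: image_subset_iff)
qed

text \<open>Letters in \<open>L\<close> are replaced by chosen preimages in \<open>F\<close>. Words
  over \<open>L\<close> thereby become elements of the type on which the universal property is
  stated.\<close>

definition embed :: "'l list \<Rightarrow> ('x + 'f + 'p) list" where
  "embed = map (\<lambda>l. Inr (Inr (inv_into (carrier F) \<pi> l)))"

lemma embed_inj: "inj_on embed (lists (carrier L))"
proof -
  have "inj_on (\<lambda>l. Inr (Inr (inv_into (carrier F) \<pi> l)) :: 'x + 'f + 'p) (carrier L)"
    using inj_on_inv_into[of "carrier L" \<pi> "carrier F"] \<pi>_surj by (simp add: inj_on_def)
  then show ?thesis unfolding embed_def by (rule inj_on_map_lists)
qed

text \<open>This is the uniqueness half of the universal property with target \<open>L\<close>,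
  obtained after copying \<open>L\<close> into the test type by one-letter words.\<close>

lemma hom_eqI:
  assumes uv: "u \<in> lie_hom K F L" "v \<in> lie_hom K F L"
    and gen: "\<And>x \<alpha>. x \<in> X \<alpha> \<Longrightarrow> u (i x) = v (i x)" and x: "x \<in> carrier F"
  shows "u x = v x"
proof -
  define t where "t = (\<lambda>l. embed [l])"
  have inj: "inj_on t (carrier L)"
    unfolding t_def by (rule inj_onI) (use inj_onD[OF embed_inj] in force)
  note t = transport[OF \<pi>.B.lie_superalgebra_axioms inj]
  have t_hom: "t \<in> lie_hom K L (transport L t)" using t(2) by (simp add: lie_iso_def)
  \<comment> \<open>The universal property gives uniqueness among extensional maps, so values
    outside the carrier are normalised.\<close>
  define r where "r w = restrict (t \<circ> w) (carrier F)" for w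
  have r: "r w \<in> lie_hom K F (transport L t) \<and> r w \<in> extensional (carrier F)"
    if "w \<in> lie_hom K F L" for w
    using lie_hom_cong[OF \<pi>.A.lie_superalgebra_axioms lie_hom_comp[OF that t_hom]]
    by (simp add: r_def)
  have gc: "i x \<in> carrier F" if "x \<in> X \<alpha>" for x \<alpha> using gen_gr[OF that] by (rule \<pi>.A.gr_closed)
  let ?P = "\<lambda>h. h \<in> lie_hom K F (transport L t) \<and> h \<in> extensional (carrier F) \<and>
    (\<forall>\<alpha>. \<forall>x\<in>X \<alpha>. h (i x) = (t \<circ> u \<circ> i) x)"
  have ex1: "\<exists>!h. ?P h"
  proof (rule free_universal[OF t(1)])
    show "(t \<circ> u \<circ> i) x \<in> gr (transport L t) \<alpha>" if "x \<in> X \<alpha>" for x \<alpha>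
      using lie_homD(5)[OF t_hom lie_homD(5)[OF uv(1) gen_gr[OF that]]] by simp
  qed
  have "?P (r u)" using r[OF uv(1)] gc by (simp add: r_def)
  moreover have "?P (r v)" using r[OF uv(2)] gc gen by (simp add: r_def)
  ultimately have "r u = r v"
    using the1_equality[of ?P, OF ex1] by (metis (no_types, lifting))
  then have "t (u x) = t (v x)" using x by (metis comp_apply r_def restrict_apply')
  then show ?thesis using inj x lie_homD(1)[OF uv(1)] lie_homD(1)[OF uv(2)] by (auto simp: inj_on_def)
qed

text \<open>Since \<open>B\<close> is stem, its elements have codes over \<open>L\<close>, so a copy
  of \<open>B\<close> fits into the test type. Freeness maps \<open>F\<close> to this copy along
  homogeneous preimages of the generators, and the inverse of the copying map leads back to
  \<open>B\<close>.\<close>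

lemma lift_exists:
  assumes B: "stem_extension K L B g"
  obtains \<beta> where "\<beta> \<in> extension_hom K F \<pi> B g"
proof -
  note extB = stem_extensionD(1)[OF B]
  interpret g: lie_morphism K B L g by (rule lie_extensionD[OF extB])
  obtain c where c: "inj_on c (carrier B)" "c ` carrier B \<subseteq> lists (carrier L)"
    by (rule stem_extension_code[OF B])
  define e where "e = embed \<circ> c"
  have inj: "inj_on e (carrier B)"
    unfolding e_def by (rule comp_inj_on[OF c(1) inj_on_subset[OF embed_inj c(2)]])
  note e = transport[OF g.A.lie_superalgebra_axioms inj]
  have e_hom: "e \<in> lie_hom K B (transport B e)" using e(2) by (simp add: lie_iso_def)
  \<comment> \<open>The degree is recovered from membership in \<open>X 0\<close>, which is
    unambiguous by disjointness. A preimage of that same degree exists by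
    \<open>gr_surj\<close>.\<close>
  define y where "y x = (SOME b. b \<in> gr B (if x \<in> X 0 then 0 else 1) \<and> g b = \<pi> (i x))" for x
  have y: "y x \<in> gr B \<alpha>" "g (y x) = \<pi> (i x)" if x: "x \<in> X \<alpha>" for x \<alpha>
  proof -
    have "\<pi> (i x) \<in> g ` gr B \<alpha>"
      unfolding g.gr_surj[OF lie_extensionD(2)[OF extB]] by (rule \<pi>.gr[OF gen_gr[OF x]])
    moreover have "(if x \<in> X 0 then 0 else 1) = \<alpha>"
      using x gen_disjoint by (cases "\<alpha> = 0") auto
    ultimately have "\<exists>b. b \<in> gr B (if x \<in> X 0 then 0 else 1) \<and> g b = \<pi> (i x)" by force
    from someI_ex[OF this] show "y x \<in> gr B \<alpha>" "g (y x) = \<pi> (i x)"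
      using \<open>_ = \<alpha>\<close> by (simp_all add: y_def)
  qed
  obtain h where h: "h \<in> lie_hom K F (transport B e)" "\<And>\<alpha> x. x \<in> X \<alpha> \<Longrightarrow> h (i x) = e (y x)"
    using ex1_implies_ex[OF free_universal[OF e(1), of "e \<circ> y"]] lie_homD(5)[OF e_hom y(1)]
    by fastforce
  define \<beta> where "\<beta> = inv_into (carrier B) e \<circ> h"
  have "inv_into (carrier B) e \<in> lie_hom K (transport B e) B"
    using lie_iso_inv[OF g.A.lie_superalgebra_axioms e] by (simp add: lie_iso_def)
  then have \<beta>: "\<beta> \<in> lie_hom K F B" unfolding \<beta>_def by (rule lie_hom_comp[OF h(1)])
  have "\<pi> (i x) = (g \<circ> \<beta>) (i x)" if x: "x \<in> X \<alpha>" for x \<alpha>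
  proof -
    have "y x \<in> carrier B" using y(1)[OF x] by (rule g.A.gr_closed)
    then have "\<beta> (i x) = y x" using h(2)[OF x] inj by (simp add: \<beta>_def)
    then show ?thesis using y(2)[OF x] by simp
  qed
  \<comment> \<open>Agreement on the generators extends to \<open>F\<close> by uniqueness, so
    \<beta> is a map over \<open>L\<close>.\<close>
  then have "\<pi> x = (g \<circ> \<beta>) x" if "x \<in> carrier F" for x
    using that by (rule hom_eqI[OF \<pi>.lie_hom lie_hom_comp[OF \<beta> g.lie_hom]])
  with \<beta> have "\<beta> \<in> extension_hom K F \<pi> B g" by (simp add: extension_hom_def)
  then show ?thesis by (rule that)
qed

abbreviation R where "R \<equiv> a_kernel F L \<pi>"

abbreviation I where "I \<equiv> commutator K F (carrier F) R"

sublocale R: graded_ideal K F R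
  by (rule \<pi>.ker_ideal)

sublocale I: graded_ideal K F I
  by (rule R.commutator_ideal)

abbreviation S where "S \<equiv> derived K F \<inter> R"

lemma S_graded: "graded_submodule K F S"
  by (rule graded_submodule_Int[OF \<pi>.A.derived_graded R.graded])

lemma S_closed: "x \<in> S \<Longrightarrow> x \<in> carrier F"
  by (rule subsetD[OF R.T.subset IntD2])

lemma S_bracket: "\<lbrakk>x \<in> S; y \<in> S\<rbrakk> \<Longrightarrow> bracket F x y \<in> S"
  using S_closed by (simp add: \<pi>.A.derivedI R.bracket_ideal_left)

lemma I_subset_derived: "I \<subseteq> derived K F"
  by (rule \<pi>.A.commutator_subset[OF subset_refl R.T.subset \<pi>.A.derived_submodule])
    (rule \<pi>.A.derivedI, assumption, rule a_kernelD)

lemma I_subset: "I \<subseteq> S"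
  using I_subset_derived R.commutator_ideal_subset by simp

sublocale S: lie_superalgebra K "sub_superalgebra F S"
  by (rule lie_superalgebra_sub[OF \<pi>.A.lie_superalgebra_axioms S_graded S_bracket])

sublocale M: graded_ideal K "sub_superalgebra F S" I
  by (rule I.graded_ideal_sub[OF S_graded S_bracket I_subset])

lemma schur_multiplier_eq: "schur_multiplier K L F \<pi> = quot_superalgebra (sub_superalgebra F S) I"
  by (simp add: schur_multiplier_def Let_def)

end

section \<open>Properties of a lift of the free presentation\<close>

locale stem_lift = lie_free_presentation K L X i F \<pi>
  for K :: "'f ring" and L :: "('f, 'l) superalgebra"
    and X :: "bit \<Rightarrow> 'x set" and i :: "'x \<Rightarrow> 'p"
    and F :: "('f, 'p) superalgebra" and \<pi> :: "'p \<Rightarrow> 'l" +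
  fixes B :: "('f, 'b) superalgebra" and g :: "'b \<Rightarrow> 'l" and \<beta> :: "'p \<Rightarrow> 'b"
  assumes stem: "stem_extension K L B g" and ext_hom: "\<beta> \<in> extension_hom K F \<pi> B g"
begin

sublocale g: lie_morphism K B L g
  by (rule lie_extensionD(1)[OF stem_extensionD(1)[OF stem]])

lemma ext_lie_hom: "\<beta> \<in> lie_hom K F B" and ext_hom_eq: "x \<in> carrier F \<Longrightarrow> g (\<beta> x) = \<pi> x"
  using ext_hom by (auto simp: extension_hom_def)

sublocale \<beta>: lie_morphism K F B \<beta>
  by (intro lie_morphism.intro lie_morphism_axioms.intro \<pi>.A.lie_superalgebra_axioms
    g.A.lie_superalgebra_axioms ext_lie_hom)

lemma in_center: "\<lbrakk>x \<in> carrier B; g x = \<zero>\<^bsub>L\<^esub>\<rbrakk> \<Longrightarrow> x \<in> lie_center B"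
  and in_derived: "\<lbrakk>x \<in> carrier B; g x = \<zero>\<^bsub>L\<^esub>\<rbrakk> \<Longrightarrow> x \<in> derived K B"
  using stem_extensionD(2,3)[OF stem] by blast+

text \<open>The difference \<open>b - \<beta> x\<close> lies in the kernel of \<open>g\<close>,
  hence is central and derived.\<close>

lemma fibre_decomp:
  assumes "b \<in> carrier B" "x \<in> carrier F" "g b = \<pi> x"
  obtains z where "z \<in> lie_center B" "z \<in> derived K B" "b = \<beta> x \<oplus>\<^bsub>B\<^esub> z"
proof
  have "g (b \<ominus>\<^bsub>B\<^esub> \<beta> x) = \<zero>\<^bsub>L\<^esub>" using assms by (simp add: ext_hom_eq)
  then show "b \<ominus>\<^bsub>B\<^esub> \<beta> x \<in> lie_center B" "b \<ominus>\<^bsub>B\<^esub> \<beta> x \<in> derived K B"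
    using assms in_center in_derived by simp_all
  show "b = \<beta> x \<oplus>\<^bsub>B\<^esub> (b \<ominus>\<^bsub>B\<^esub> \<beta> x)"
    using assms by (simp add: a_minus_def g.A.M.a_lcomm g.A.M.r_neg)
qed

lemma fibre_exists:
  assumes "b \<in> carrier B"
  obtains x where "x \<in> carrier F" "g b = \<pi> x"
proof -
  have "g b \<in> \<pi> ` carrier F" unfolding \<pi>_surj using assms by simp
  then show ?thesis using that by blast
qed

text \<open>Every element of \<open>B\<close> is a value of \<beta> up to a central summand, and
  brackets ignore such summands.\<close>

lemma derived_subset_image: "derived K B \<subseteq> \<beta> ` derived K F"
proof (rule g.A.commutator_subset[OF subset_refl subset_refl])
  show "submodule K (\<beta> ` derived K F) B"
    by (rule \<beta>.lin.image_submodule[OF \<pi>.A.derived_submodule])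
  fix b c assume bc: "b \<in> carrier B" "c \<in> carrier B"
  obtain x where x: "x \<in> carrier F" "g b = \<pi> x" using fibre_exists[OF bc(1)] .
  obtain y where y: "y \<in> carrier F" "g c = \<pi> y" using fibre_exists[OF bc(2)] .
  obtain z where z: "z \<in> lie_center B" "b = \<beta> x \<oplus>\<^bsub>B\<^esub> z" using fibre_decomp[OF bc(1) x] .
  obtain w where w: "w \<in> lie_center B" "c = \<beta> y \<oplus>\<^bsub>B\<^esub> w" using fibre_decomp[OF bc(2) y] .
  have "bracket B b c = \<beta> (bracket F x y)"
    using x(1) y(1) z(1) w(1) by (simp add: z(2) w(2) g.A.bracket_add_center)
  then show "bracket B b c \<in> \<beta> ` derived K F"
    using \<pi>.A.derivedI[OF x(1) y(1)] by blast
qed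

text \<open>The correction term of \<open>fibre_decomp\<close> lies in the derived algebra of
  \<open>B\<close>, which is already known to be in the image.\<close>

lemma surj: "\<beta> ` carrier F = carrier B"
proof
  show "carrier B \<subseteq> \<beta> ` carrier F"
  proof
    fix b assume b: "b \<in> carrier B"
    obtain x where x: "x \<in> carrier F" "g b = \<pi> x" using fibre_exists[OF b] .
    obtain z where z: "z \<in> derived K B" "b = \<beta> x \<oplus>\<^bsub>B\<^esub> z" using fibre_decomp[OF b x] .
    obtain d where d: "d \<in> derived K F" "z = \<beta> d" using derived_subset_image z(1) by blast
    then have "b = \<beta> (x \<oplus>\<^bsub>F\<^esub> d)" using x \<pi>.A.derived_closed by (simp add: z(2))
    then show "b \<in> \<beta> ` carrier F" using x d \<pi>.A.derived_closed by blast
  qed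
qed auto

lemma zero_imp_R: "\<lbrakk>x \<in> carrier F; \<beta> x = \<zero>\<^bsub>B\<^esub>\<rbrakk> \<Longrightarrow> x \<in> R"
  using ext_hom_eq[of x] by (intro a_kernelI) simp_all

lemma R_center: "r \<in> R \<Longrightarrow> \<beta> r \<in> lie_center B"
  using a_kernelD[of r F L \<pi>] by (intro in_center) (simp_all add: ext_hom_eq)

text \<open>The lift sends \<open>R\<close> into the centre of \<open>B\<close>, so it kills
  brackets of \<open>F\<close> with \<open>R\<close>.\<close>

lemma I_zero: "x \<in> I \<Longrightarrow> \<beta> x = \<zero>\<^bsub>B\<^esub>"
proof -
  have "I \<subseteq> a_kernel F B \<beta>"
  proof (rule \<pi>.A.commutator_subset[OF subset_refl R.T.subset \<beta>.ker_submodule])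
    fix x r assume x: "x \<in> carrier F" and r: "r \<in> R"
    show "bracket F x r \<in> a_kernel F B \<beta>"
      using x a_kernelD(1)[OF r] g.A.center_right[OF R_center[OF r]]
      by (intro a_kernelI) (simp_all add: \<pi>.A.bracket_closed)
  qed
  then show "x \<in> I \<Longrightarrow> \<beta> x = \<zero>\<^bsub>B\<^esub>" by (rule a_kernelD(2)[OF subsetD])
qed

text \<open>A kernel element is derived, so it is \<open>\<beta> d\<close> for some \<open>d\<close>
  in the derived algebra of \<open>F\<close>; then \<open>\<pi> d = g (\<beta> d) = 0\<close> puts
  \<open>d\<close> into \<open>R\<close>.\<close>

lemma kernel_onto: "\<beta> ` S = a_kernel B L g"
proof
  show "\<beta> ` S \<subseteq> a_kernel B L g"
  proof (rule image_subsetI, rule a_kernelI)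
    fix x assume x: "x \<in> S"
    then show "\<beta> x \<in> carrier B" by (intro \<beta>.lin.f_im S_closed)
    show "g (\<beta> x) = \<zero>\<^bsub>L\<^esub>" using ext_hom_eq[OF S_closed[OF x]] a_kernelD(2)[OF IntD2[OF x]] by simp
  qed
  show "a_kernel B L g \<subseteq> \<beta> ` S"
  proof
    fix m assume "m \<in> a_kernel B L g"
    note m = a_kernelD[OF this]
    obtain d where d: "d \<in> derived K F" "m = \<beta> d"
      using subsetD[OF derived_subset_image in_derived[OF m]] by blast
    then have "d \<in> R"
      using m(2) ext_hom_eq \<pi>.A.derived_closed[OF d(1)] by (intro a_kernelI) simp_all
    then show "m \<in> \<beta> ` S" using d by blast
  qed
qed

text \<open>Two lifts differ at each point by a central element, so they agree on brackets and hence
  on their span.\<close>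

lemma ext_hom_agree:
  assumes \<gamma>: "\<gamma> \<in> extension_hom K F \<pi> B g" and "d \<in> derived K F"
  shows "\<gamma> d = \<beta> d"
proof -
  interpret \<gamma>: lie_morphism K F B \<gamma>
    by (intro lie_morphism.intro lie_morphism_axioms.intro \<pi>.A.lie_superalgebra_axioms
      g.A.lie_superalgebra_axioms) (use \<gamma> in \<open>simp add: extension_hom_def\<close>)
  have "derived K F \<subseteq> {x \<in> carrier F. \<gamma> x = \<beta> x}"
  proof (rule \<pi>.A.commutator_subset[OF subset_refl subset_refl])
    show "submodule K {x \<in> carrier F. \<gamma> x = \<beta> x} F"
      by (intro submodule.intro \<pi>.A.module_axioms) auto
    fix x y assume xy: "x \<in> carrier F" "y \<in> carrier F"
    have g\<gamma>: "g (\<gamma> x) = \<pi> x" "g (\<gamma> y) = \<pi> y"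
      using \<gamma> xy by (simp_all add: extension_hom_def)
    obtain z where z: "z \<in> lie_center B" "\<gamma> x = \<beta> x \<oplus>\<^bsub>B\<^esub> z"
      using fibre_decomp[OF \<gamma>.lin.f_im[OF xy(1)] xy(1) g\<gamma>(1)] .
    obtain w where w: "w \<in> lie_center B" "\<gamma> y = \<beta> y \<oplus>\<^bsub>B\<^esub> w"
      using fibre_decomp[OF \<gamma>.lin.f_im[OF xy(2)] xy(2) g\<gamma>(2)] .
    have "\<gamma> (bracket F x y) = \<beta> (bracket F x y)"
      using xy z(1) w(1) by (simp add: z(2) w(2) g.A.bracket_add_center)
    then show "bracket F x y \<in> {x \<in> carrier F. \<gamma> x = \<beta> x}"
      using xy by (simp add: \<pi>.A.bracket_closed)
  qed
  then show ?thesis using assms(2) by blast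
qed

section \<open>The natural map from the multiplier onto the kernel\<close>

abbreviation \<nu> where "\<nu> \<equiv> \<lambda>X. the_elem (\<beta> ` X)"

abbreviation SM where "SM \<equiv> quot_superalgebra (sub_superalgebra F S) I"

abbreviation N where "N \<equiv> sub_superalgebra B (a_kernel B L g)"

lemma kernel_lie: "lie_superalgebra K N"
proof (rule lie_superalgebra_sub[OF g.A.lie_superalgebra_axioms g.ker_graded])
  interpret k: graded_ideal K B "a_kernel B L g" by (rule g.ker_ideal)
  show "bracket B x y \<in> a_kernel B L g" if "x \<in> a_kernel B L g" "y \<in> a_kernel B L g" for x y
    using that k.T.subset by (intro k.bracket_ideal_left) auto
qed

lemma restrict_hom: "\<beta> \<in> lie_hom K (sub_superalgebra F S) N"
proof (rule lie_homI)
  show "\<beta> x \<in> carrier N" if "x \<in> carrier (sub_superalgebra F S)" for x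
    using that kernel_onto by (auto simp: sub_superalgebra_sel)
  show "\<beta> x \<in> gr N \<alpha>" if "x \<in> gr (sub_superalgebra F S) \<alpha>" for x \<alpha>
    using that kernel_onto \<beta>.gr by (auto simp: sub_superalgebra_sel)
qed (use S_closed in \<open>simp_all add: sub_superalgebra_sel\<close>)

text \<open>Because \<beta> vanishes on \<open>I\<close>, it is constant on each coset; the image is
  a singleton and \<open>the_elem\<close> returns its value.\<close>

lemma natural_coset: "x \<in> S \<Longrightarrow> \<nu> (I +>\<^bsub>sub_superalgebra F S\<^esub> x) = \<beta> x"
proof -
  assume x: "x \<in> S"
  have "\<beta> y = \<beta> x" if "y \<in> I +>\<^bsub>sub_superalgebra F S\<^esub> x" for y
    using that
  proof (rule M.coset_memE)
    fix t assume t: "t \<in> I" "y = t \<oplus>\<^bsub>sub_superalgebra F S\<^esub> x"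
    then have "t \<in> carrier F" "x \<in> carrier F" using x I_subset S_closed by blast+
    then show "\<beta> y = \<beta> x" using t I_zero by (simp add: sub_superalgebra_sel)
  qed
  moreover have "x \<in> I +>\<^bsub>sub_superalgebra F S\<^esub> x"
    using x by (intro M.T.a_rcos_self) (simp add: sub_superalgebra_sel)
  ultimately have "\<beta> ` (I +>\<^bsub>sub_superalgebra F S\<^esub> x) = {\<beta> x}" by blast
  then show ?thesis by simp
qed

lemma natural_hom: "\<nu> \<in> lie_hom K SM N"
proof (rule lie_hom_factor[OF S.lie_superalgebra_axioms M.quot_lie_superalgebra kernel_lie
      M.quot_hom M.quot_carrier restrict_hom])
  fix x assume "x \<in> carrier (sub_superalgebra F S)"
  then have x: "x \<in> S" by (simp add: sub_superalgebra_sel)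
  then show "\<nu> (I +>\<^bsub>sub_superalgebra F S\<^esub> x) = \<beta> x" by (rule natural_coset)
  assume "I +>\<^bsub>sub_superalgebra F S\<^esub> x = \<zero>\<^bsub>SM\<^esub>"
  then have "x \<in> I" using x by (simp add: M.quot_zero M.coset_eq_iff sub_superalgebra_sel)
  then show "\<beta> x = \<zero>\<^bsub>N\<^esub>" by (simp add: I_zero sub_superalgebra_sel)
qed

lemma natural_surj: "\<nu> ` carrier SM = carrier N"
proof -
  have "\<nu> ` carrier SM = (\<lambda>x. \<nu> (I +>\<^bsub>sub_superalgebra F S\<^esub> x)) ` S"
    unfolding M.quot_carrier[symmetric] by (simp add: image_image sub_superalgebra_sel)
  also have "\<dots> = \<beta> ` S" by (rule image_cong[OF refl natural_coset])
  finally show ?thesis by (simp add: kernel_onto sub_superalgebra_sel)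
qed

text \<open>Surjectivity always holds, so only injectivity is at stake. The condition can range over
  the whole derived algebra, since \<beta>-zeros lie in \<open>R\<close> by
  \<open>zero_imp_R\<close>.\<close>

lemma natural_iso_iff: "\<nu> \<in> lie_iso K SM N \<longleftrightarrow> (\<forall>d\<in>derived K F. \<beta> d = \<zero>\<^bsub>B\<^esub> \<longrightarrow> d \<in> I)"
proof
  assume "\<nu> \<in> lie_iso K SM N"
  then have inj: "inj_on \<nu> (carrier SM)" by (simp add: lie_iso_def bij_betw_def)
  show "\<forall>d\<in>derived K F. \<beta> d = \<zero>\<^bsub>B\<^esub> \<longrightarrow> d \<in> I"
  proof (intro ballI impI)
    fix d assume d: "d \<in> derived K F" "\<beta> d = \<zero>\<^bsub>B\<^esub>"
    have dS: "d \<in> S" using d(1) zero_imp_R[OF \<pi>.A.derived_closed[OF d(1)] d(2)] by (rule IntI)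
    have 0: "\<zero>\<^bsub>F\<^esub> \<in> S" using M.T.zero_closed I_subset by (auto simp: sub_superalgebra_sel)
    have "I +>\<^bsub>sub_superalgebra F S\<^esub> d = I +>\<^bsub>sub_superalgebra F S\<^esub> \<zero>\<^bsub>F\<^esub>"
    proof (rule inj_onD[OF inj])
      show "\<nu> (I +>\<^bsub>sub_superalgebra F S\<^esub> d) = \<nu> (I +>\<^bsub>sub_superalgebra F S\<^esub> \<zero>\<^bsub>F\<^esub>)"
        using d natural_coset[OF dS] natural_coset[OF 0] by simp
    qed (use dS 0 M.quot_carrier in \<open>auto simp: sub_superalgebra_sel\<close>)
    also have "\<dots> = I" using M.T.a_rcos_const M.T.zero_closed by (simp add: sub_superalgebra_sel)
    finally show "d \<in> I" using dS by (simp add: M.coset_eq_iff sub_superalgebra_sel)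
  qed
next
  assume *: "\<forall>d\<in>derived K F. \<beta> d = \<zero>\<^bsub>B\<^esub> \<longrightarrow> d \<in> I"
  interpret \<nu>: lie_morphism K SM N \<nu>
    by (intro lie_morphism.intro lie_morphism_axioms.intro M.quot_lie_superalgebra kernel_lie natural_hom)
  have "inj_on \<nu> (carrier SM)"
  proof (rule \<nu>.inj_onI)
    fix Y assume "Y \<in> carrier SM" "\<nu> Y = \<zero>\<^bsub>N\<^esub>"
    then obtain x where x: "x \<in> S" "Y = I +>\<^bsub>sub_superalgebra F S\<^esub> x"
      unfolding M.quot_carrier[symmetric] by (auto simp: sub_superalgebra_sel)
    then have "\<beta> x = \<zero>\<^bsub>B\<^esub>"
      using \<open>\<nu> Y = \<zero>\<^bsub>N\<^esub>\<close> natural_coset by (simp add: sub_superalgebra_sel)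
    then have "x \<in> I" using * x by blast
    then show "Y = \<zero>\<^bsub>SM\<^esub>" unfolding x(2) M.quot_zero by (rule M.T.a_rcos_const)
  qed
  then show "\<nu> \<in> lie_iso K SM N"
    using natural_hom natural_surj by (simp add: lie_iso_def bij_betw_def)
qed

end

section \<open>Maximality\<close>

text \<open>A non-zero kernel vector extends to a generating set of at most \<open>dim V\<close> elements; the image of
  the other ones still generates, and there are fewer of them.\<close>

lemma fin_dim_surj_imp_inj:
  assumes "vectorspace K V" and T: "T \<in> module_hom K V V" and surj: "T ` carrier V = carrier V"
    and fd: "vectorspace.fin_dim K V"
    and x: "x \<in> carrier V" "T x = \<zero>\<^bsub>V\<^esub>"
  shows "x = \<zero>\<^bsub>V\<^esub>"
proof (rule ccontr)
  assume nz: "x \<noteq> \<zero>\<^bsub>V\<^esub>"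
  interpret V: vectorspace K V by fact
  interpret T: linear_map K V V T by unfold_locales (rule T)
  obtain \<beta> where \<beta>: "finite \<beta>" "V.basis \<beta>" using V.finite_basis_exists[OF fd] by blast
  then have gen: "V.span \<beta> = carrier V" "\<beta> \<subseteq> carrier V" "V.dim = card \<beta>"
    by (simp_all add: V.basis_def V.dim_basis)
  have empty: "V.lin_indpt {}" by (auto simp: V.lin_dep_def)
  have "V.lin_indpt {x}"
    using V.lin_dep_iff_in_span[OF _ empty x(1)] nz by (simp add: V.span_empty)
  then obtain C where C: "finite C" "C \<subseteq> carrier V" "int (card C) \<le> int (card \<beta>) - 1"
      "V.span ({x} \<union> C) = carrier V"
    using V.replacement[of "{x}" \<beta>] \<beta>(1) gen x(1) by auto
  have TC: "T ` C \<subseteq> carrier V" using C(2) by auto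
  have "V.span ({x} \<union> C) \<subseteq> {v \<in> carrier V. T v \<in> V.span (T ` C)}"
  proof (rule V.span_is_subset)
    show "submodule K {v \<in> carrier V. T v \<in> V.span (T ` C)} V"
      by (rule T.vimage_submodule[OF V.span_is_submodule[OF TC]])
    show "{x} \<union> C \<subseteq> {v \<in> carrier V. T v \<in> V.span (T ` C)}"
      using x C(2) V.in_own_span[OF TC] submodule.zero_closed[OF V.span_is_submodule[OF TC]] by auto
  qed
  then have "T ` carrier V \<subseteq> V.span (T ` C)" unfolding C(4) by blast
  then have "V.span (T ` C) = carrier V"
    using surj V.span_is_subset2[OF TC] by simp
  then have "V.dim \<le> card (T ` C)" using C(1) TC by (intro V.gen_ge_dim) simp_all
  then show False using card_image_le[OF C(1), of T] C(3) gen(3) by linarith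
qed

section \<open>Enlarging graded subspaces\<close>

lemma graded_submodule_Union_chain:
  assumes C: "C \<noteq> {}" "\<And>S. S \<in> C \<Longrightarrow> graded_submodule K A S"
    and chain: "\<And>S T. \<lbrakk>S \<in> C; T \<in> C\<rbrakk> \<Longrightarrow> S \<subseteq> T \<or> T \<subseteq> S"
  shows "graded_submodule K A (\<Union>C)"
proof -
  note sub = graded_submoduleD(1)[OF C(2)]
  have add: "v \<oplus>\<^bsub>A\<^esub> w \<in> \<Union>C" if "v \<in> \<Union>C" "w \<in> \<Union>C" for v w
  proof -
    obtain S T where "S \<in> C" "T \<in> C" "v \<in> S" "w \<in> T" using \<open>v \<in> \<Union>C\<close> \<open>w \<in> \<Union>C\<close> by blast
    then obtain U where "U \<in> C" "v \<in> U" "w \<in> U" using chain by blast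
    then show ?thesis using submodule.m_closed[OF sub] by blast
  qed
  have "submodule K (\<Union>C) A"
  proof (rule submodule.intro)
    obtain S where "S \<in> C" using C(1) by blast
    then show "module K A" "\<zero>\<^bsub>A\<^esub> \<in> \<Union>C"
      using submodule.module[OF sub] submodule.zero_closed[OF sub] by blast+
    show "\<Union>C \<subseteq> carrier A" using submodule.subset[OF sub] by blast
    show "c \<odot>\<^bsub>A\<^esub> v \<in> \<Union>C" if "c \<in> carrier K" "v \<in> \<Union>C" for c v
      using that submodule.smult_closed[OF sub] by blast
  qed (rule add)
  moreover have "x \<in> \<Union>C \<and> y \<in> \<Union>C"
    if xy: "x \<in> gr A 0" "y \<in> gr A 1" "x \<oplus>\<^bsub>A\<^esub> y \<in> \<Union>C" for x y
  proof -
    obtain S where S: "S \<in> C" "x \<oplus>\<^bsub>A\<^esub> y \<in> S" using xy(3) by blast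
    show ?thesis using graded_submoduleD(2,3)[OF C(2)[OF S(1)] xy(1,2) S(2)] S(1) by blast
  qed
  ultimately show ?thesis by (simp add: graded_submodule_def)
qed

text \<open>As \<open>x\<close> is homogeneous, its multiple joins the component of \<open>t\<close>
  of the same degree and leaves the other one in \<open>T\<close>.\<close>

lemma (in lie_superalgebra) adjoin_graded:
  assumes T: "graded_submodule K L T" and x: "x \<in> gr L \<alpha>"
  shows "graded_submodule K L {t \<oplus>\<^bsub>L\<^esub> c \<odot>\<^bsub>L\<^esub> x | t c. t \<in> T \<and> c \<in> carrier K}" (is "graded_submodule K L ?T")
proof (rule graded_submoduleI)
  interpret T: submodule K T L by (rule graded_submoduleD[OF T])
  have xc: "x \<in> carrier L" using x by (rule gr_closed)
  have tc: "t \<in> carrier L" if "t \<in> T" for t using T.subset that by (rule subsetD)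
  have mem: "t \<oplus>\<^bsub>L\<^esub> c \<odot>\<^bsub>L\<^esub> x \<in> ?T" if "t \<in> T" "c \<in> carrier K" for t c using that by blast
  have mem0: "t \<in> ?T" if "t \<in> T" for t
    using mem[OF that R.zero_closed] xc tc[OF that] by simp
  show "submodule K ?T L"
  proof
    show "?T \<subseteq> carrier L" using tc xc by auto
    show "\<zero>\<^bsub>L\<^esub> \<in> ?T" by (rule mem0[OF T.zero_closed])
    fix v w assume "v \<in> ?T" "w \<in> ?T"
    then obtain t c s d where tcsd: "t \<in> T" "c \<in> carrier K" "s \<in> T" "d \<in> carrier K"
      "v = t \<oplus>\<^bsub>L\<^esub> c \<odot>\<^bsub>L\<^esub> x" "w = s \<oplus>\<^bsub>L\<^esub> d \<odot>\<^bsub>L\<^esub> x" by blast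
    then have "v \<oplus>\<^bsub>L\<^esub> w = (t \<oplus>\<^bsub>L\<^esub> s) \<oplus>\<^bsub>L\<^esub> (c \<oplus>\<^bsub>K\<^esub> d) \<odot>\<^bsub>L\<^esub> x"
      using xc tc by (simp add: smult_l_distr M.a_ac)
    then show "v \<oplus>\<^bsub>L\<^esub> w \<in> ?T" using mem[of "t \<oplus>\<^bsub>L\<^esub> s" "c \<oplus>\<^bsub>K\<^esub> d"] tcsd by simp
  next
    fix k v assume k: "k \<in> carrier K" "v \<in> ?T"
    then obtain t c where tc': "t \<in> T" "c \<in> carrier K" "v = t \<oplus>\<^bsub>L\<^esub> c \<odot>\<^bsub>L\<^esub> x" by blast
    then have "k \<odot>\<^bsub>L\<^esub> v = k \<odot>\<^bsub>L\<^esub> t \<oplus>\<^bsub>L\<^esub> (k \<otimes>\<^bsub>K\<^esub> c) \<odot>\<^bsub>L\<^esub> x"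
      using xc tc k by (simp add: smult_r_distr smult_assoc1)
    then show "k \<odot>\<^bsub>L\<^esub> v \<in> ?T" using mem[of "k \<odot>\<^bsub>L\<^esub> t" "k \<otimes>\<^bsub>K\<^esub> c"] tc' k by simp
  qed
  fix y assume "y \<in> ?T"
  then obtain t c where t: "t \<in> T" "c \<in> carrier K" "y = t \<oplus>\<^bsub>L\<^esub> c \<odot>\<^bsub>L\<^esub> x" by blast
  obtain a b where ab: "a \<in> T" "b \<in> T" "a \<in> gr L 0" "b \<in> gr L 1" "t = a \<oplus>\<^bsub>L\<^esub> b"
    using graded_submodule_decomp[OF T t(1)] .
  note car = tc[OF ab(1)] tc[OF ab(2)] xc t(2)
  show "\<exists>a\<in>?T \<inter> gr L 0. \<exists>b\<in>?T \<inter> gr L 1. y = a \<oplus>\<^bsub>L\<^esub> b"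
  proof (cases "\<alpha> = 0")
    case True
    show ?thesis
    proof (intro bexI IntI)
      show "y = (a \<oplus>\<^bsub>L\<^esub> c \<odot>\<^bsub>L\<^esub> x) \<oplus>\<^bsub>L\<^esub> b"
        using car by (simp add: t(3) ab(5) M.a_ac)
      show "a \<oplus>\<^bsub>L\<^esub> c \<odot>\<^bsub>L\<^esub> x \<in> gr L 0" using gr_add[OF ab(3) gr_smult[OF t(2)]] x True by simp
    qed (use mem[OF ab(1) t(2)] mem0[OF ab(2)] ab(4) in simp_all)
  next
    case False
    show ?thesis
    proof (intro bexI IntI)
      show "y = a \<oplus>\<^bsub>L\<^esub> (b \<oplus>\<^bsub>L\<^esub> c \<odot>\<^bsub>L\<^esub> x)"
        using car by (simp add: t(3) ab(5) M.a_ac)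
      show "b \<oplus>\<^bsub>L\<^esub> c \<odot>\<^bsub>L\<^esub> x \<in> gr L 1" using gr_add[OF ab(4) gr_smult[OF t(2)]] x False by simp
    qed (use mem[OF ab(2) t(2)] mem0[OF ab(1)] ab(3) in simp_all)
  qed
qed

text \<open>The projection of the copy is \<open>f\<close> factored through \<open>e\<close>. Being
  stem then passes along \<open>e\<close> by \<open>stem_extension_image\<close>.\<close>

lemma stem_extension_transport:
  assumes A: "stem_extension K L A f" and inj: "inj_on e (carrier A)"
  obtains f' where "stem_extension K L (transport A e) f'" "\<And>x. x \<in> carrier A \<Longrightarrow> f' (e x) = f x"
proof -
  note ext = stem_extensionD(1)[OF A]
  interpret f: lie_morphism K A L f by (rule lie_extensionD(1)[OF ext])
  note tr = transport[OF f.A.lie_superalgebra_axioms inj]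
  have e: "e \<in> lie_hom K A (transport A e)" "e ` carrier A = carrier (transport A e)"
    using tr(2) by (simp_all add: lie_iso_def bij_betw_def)
  interpret e: lie_morphism K A "transport A e" e
    by (intro lie_morphism.intro lie_morphism_axioms.intro f.A.lie_superalgebra_axioms tr(1) e(1))
  have ker: "f x = \<zero>\<^bsub>L\<^esub>" if "x \<in> carrier A" "e x = \<zero>\<^bsub>transport A e\<^esub>" for x
  proof -
    have "x = \<zero>\<^bsub>A\<^esub>" using inj that by (metis e.lin.f0_is_0 f.A.M.zero_closed inj_onD)
    then show ?thesis by simp
  qed
  obtain f' where f': "f' \<in> lie_hom K (transport A e) L" "\<And>x. x \<in> carrier A \<Longrightarrow> f' (e x) = f x"
    using lie_hom_factor_exists[OF f.A.lie_superalgebra_axioms tr(1)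
        f.B.lie_superalgebra_axioms e f.lie_hom ker] by blast
  have "stem_extension K L (transport A e) f'"
  proof (rule stem_extension_image[OF ext tr(1) e f'])
    fix r assume "r \<in> a_kernel A L f"
    note r = a_kernelD[OF this]
    show "\<exists>d\<in>derived K A. e r = e d" using stem_extensionD(3)[OF A r] by blast
    show "e (bracket A r x) = \<zero>\<^bsub>transport A e\<^esub>" if "x \<in> carrier A" for x
      using stem_extensionD(2)[OF A r] that by (simp add: lie_center_def del: e.bracket)
  qed
  then show ?thesis using that f'(2) by blast
qed

section \<open>Maximal stem extensions and the natural map\<close>

context stem_lift
begin

text \<open>The definition allows any lift, but all lifts agree on the derived algebra of
  \<open>F\<close>, so the criterion may be tested on the fixed \<beta>.\<close>

lemma natural_stem_cover_iff:
  "natural_stem_cover K L F \<pi> B g \<longleftrightarrow> (\<forall>d\<in>derived K F. \<beta> d = \<zero>\<^bsub>B\<^esub> \<longrightarrow> d \<in> I)"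
proof
  assume "natural_stem_cover K L F \<pi> B g"
  then obtain \<gamma> where \<gamma>: "\<gamma> \<in> extension_hom K F \<pi> B g"
    "(\<lambda>X. the_elem (\<gamma> ` X)) \<in> lie_iso K SM N"
    by (auto simp: natural_stem_cover_def schur_multiplier_eq)
  interpret \<gamma>: stem_lift K L X i F \<pi> B g \<gamma>
    by (intro stem_lift.intro stem_lift_axioms.intro lie_free_presentation_axioms stem \<gamma>(1))
  show "\<forall>d\<in>derived K F. \<beta> d = \<zero>\<^bsub>B\<^esub> \<longrightarrow> d \<in> I"
    using \<gamma>.natural_iso_iff \<gamma>(2) ext_hom_agree[OF \<gamma>(1)] by simp
next
  assume "\<forall>d\<in>derived K F. \<beta> d = \<zero>\<^bsub>B\<^esub> \<longrightarrow> d \<in> I"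
  then show "natural_stem_cover K L F \<pi> B g"
    using natural_iso_iff stem ext_hom by (auto simp: natural_stem_cover_def schur_multiplier_eq)
qed

lemma natural_imp_maximal:
  assumes nat: "\<forall>d\<in>derived K F. \<beta> d = \<zero>\<^bsub>B\<^esub> \<longrightarrow> d \<in> I"
  shows "maximal_stem_extension K L B g"
  unfolding maximal_stem_extension_def
proof (intro conjI allI impI stem; elim conjE)
  fix C :: "('f, 'l list) superalgebra" and f' h
  assume C: "stem_extension K L C f'" and h: "h \<in> extension_hom K C f' B g" "h ` carrier C = carrier B"
  obtain \<gamma> where \<gamma>: "\<gamma> \<in> extension_hom K F \<pi> C f'" using lift_exists[OF C] .
  interpret C: stem_lift K L X i F \<pi> C f' \<gamma>
    by (intro stem_lift.intro stem_lift_axioms.intro lie_free_presentation_axioms C \<gamma>)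
  have hom: "h \<in> lie_hom K C B" and fh: "\<And>c. c \<in> carrier C \<Longrightarrow> f' c = g (h c)"
    using h(1) by (auto simp: extension_hom_def)
  interpret h: lie_morphism K C B h
    by (intro lie_morphism.intro lie_morphism_axioms.intro C.g.A.lie_superalgebra_axioms
      g.A.lie_superalgebra_axioms hom)
  \<comment> \<open>Following a lift to \<open>C\<close> by the epimorphism gives a second lift to
    \<open>B\<close>, which must agree with \<beta> on the derived algebra.\<close>
  have "h \<circ> \<gamma> \<in> extension_hom K F \<pi> B g"
    using lie_hom_comp[OF C.ext_lie_hom hom] C.ext_hom_eq fh by (simp add: extension_hom_def)
  note agree = ext_hom_agree[OF this]
  have "inj_on h (carrier C)"
  proof (rule h.inj_onI)
    fix c assume c: "c \<in> carrier C" "h c = \<zero>\<^bsub>B\<^esub>"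
    then have "f' c = \<zero>\<^bsub>L\<^esub>" by (simp add: fh)
    \<comment> \<open>As \<open>C\<close> is stem, \<open>c\<close> is derived and hence comes from
      the derived algebra of \<open>F\<close>; this is where the hypothesis on \<beta> can be
      applied.\<close>
    then obtain d where d: "d \<in> derived K F" "c = \<gamma> d"
      using subsetD[OF C.derived_subset_image C.in_derived[OF c(1)]] by blast
    then have "\<beta> d = \<zero>\<^bsub>B\<^esub>" using agree[OF d(1)] c(2) by simp
    then show "c = \<zero>\<^bsub>C\<^esub>" using nat d C.I_zero by blast
  qed
  then show "h \<in> lie_iso K C B" using hom h(2) by (simp add: lie_iso_def bij_betw_def)
qed

lemma ker_subset_R: "a_kernel F B \<beta> \<subseteq> R"
  by (rule subsetI, rule zero_imp_R) (erule a_kernelD)+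

text \<open>Take \<open>T\<close> maximal among graded subspaces between \<open>I\<close> and the
  kernel that meet the derived algebra inside \<open>I\<close>. A homogeneous kernel vector outside
  \<open>T + [F, F]\<close> could be adjoined, contradicting maximality.\<close>

lemma complement_exists:
  obtains T where "graded_submodule K F T" "I \<subseteq> T" "T \<subseteq> a_kernel F B \<beta>" "T \<inter> derived K F \<subseteq> I"
    "a_kernel F B \<beta> \<subseteq> \<pi>.A.submodule_sum T (derived K F)"
proof -
  let ?D = "derived K F"
  define Z where "Z = {T. graded_submodule K F T \<and> I \<subseteq> T \<and> T \<subseteq> a_kernel F B \<beta> \<and> T \<inter> ?D \<subseteq> I}"
  have "I \<subseteq> a_kernel F B \<beta>"
    using I_zero I.T.subset by (intro subsetI a_kernelI) auto
  then have "I \<in> Z" using I.graded by (simp add: Z_def)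
  moreover have "\<Union>C \<in> Z" if C: "C \<noteq> {}" "subset.chain Z C" for C
  proof -
    have Cd: "graded_submodule K F T" "I \<subseteq> T" "T \<subseteq> a_kernel F B \<beta>" "T \<inter> ?D \<subseteq> I" if "T \<in> C" for T
      using C(2) that by (auto simp: subset.chain_def Z_def)
    have "graded_submodule K F (\<Union>C)"
      using C by (intro graded_submodule_Union_chain Cd(1)) (auto simp: subset.chain_def)
    moreover have "I \<subseteq> \<Union>C" using C(1) Cd(2) by blast
    moreover have "\<Union>C \<subseteq> a_kernel F B \<beta>" using Cd(3) by blast
    moreover have "\<Union>C \<inter> ?D \<subseteq> I" using Cd(4) by blast
    ultimately show ?thesis by (simp add: Z_def)
  qed
  ultimately obtain T where "T \<in> Z" and max: "\<And>T'. \<lbrakk>T' \<in> Z; T \<subseteq> T'\<rbrakk> \<Longrightarrow> T' = T"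
    using subset_Zorn_nonempty[of Z] by blast
  then have T: "graded_submodule K F T" "I \<subseteq> T" "T \<subseteq> a_kernel F B \<beta>" "T \<inter> ?D \<subseteq> I"
    by (simp_all add: Z_def)
  interpret T: submodule K T F by (rule graded_submoduleD[OF T(1)])
  interpret D: submodule K ?D F by (rule \<pi>.A.derived_submodule)
  let ?W = "\<pi>.A.submodule_sum T ?D"
  have W: "submodule K ?W F" by (rule \<pi>.A.sum_is_submodule[OF T.submodule_axioms D.submodule_axioms])
  have memW: "t \<oplus>\<^bsub>F\<^esub> d \<in> ?W" if "t \<in> T" "d \<in> ?D" for t d
    using that unfolding \<pi>.A.submodule_sum_iff by blast
  have tF: "t \<in> carrier F" if "t \<in> T" for t using T.subset that by (rule subsetD)
  \<comment> \<open>Only a homogeneous vector can be adjoined without losing gradedness. This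
    suffices, because the kernel is graded and is spanned by its homogeneous elements.\<close>
  have homogeneous: "x \<in> ?W" if x: "x \<in> a_kernel F B \<beta>" "x \<in> gr F \<alpha>" for x \<alpha>
  proof (rule ccontr)
    assume xW: "x \<notin> ?W"
    note xF = a_kernelD(1)[OF x(1)]
    let ?T = "{t \<oplus>\<^bsub>F\<^esub> c \<odot>\<^bsub>F\<^esub> x | t c. t \<in> T \<and> c \<in> carrier K}"
    have mem: "t \<oplus>\<^bsub>F\<^esub> c \<odot>\<^bsub>F\<^esub> x \<in> ?T" if "t \<in> T" "c \<in> carrier K" for t c using that by blast
    have sub: "T \<subseteq> ?T"
    proof
      fix t assume "t \<in> T"
      then show "t \<in> ?T" using mem[of t "\<zero>\<^bsub>K\<^esub>"] xF tF by simp
    qed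
    have "?T \<inter> ?D \<subseteq> I"
    proof
      fix y assume y: "y \<in> ?T \<inter> ?D"
      then obtain t c where t: "t \<in> T" "c \<in> carrier K" "y = t \<oplus>\<^bsub>F\<^esub> c \<odot>\<^bsub>F\<^esub> x" by blast
      show "y \<in> I"
      proof (cases "c = \<zero>\<^bsub>K\<^esub>")
        case True
        then have "y = t" using t xF tF by simp
        then show ?thesis using T(4) t(1) y by blast
      next
        case False
        define k where "k = inv\<^bsub>K\<^esub> c"
        have k: "k \<in> carrier K" "k \<otimes>\<^bsub>K\<^esub> c = \<one>\<^bsub>K\<^esub>"
          using False t(2) \<pi>.A.field_Units by (auto simp: k_def)
        \<comment> \<open>With \<open>c\<close> invertible, a derived \<open>y = t + c x\<close>
          would place \<open>x\<close> in the sum of \<open>T\<close> and the derived algebra,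
          against the choice of \<open>x\<close>.\<close>
        have "c \<odot>\<^bsub>F\<^esub> x = \<ominus>\<^bsub>F\<^esub> t \<oplus>\<^bsub>F\<^esub> y"
          using t xF tF[OF t(1)] by (simp add: \<pi>.A.M.r_neg1)
        then have "k \<odot>\<^bsub>F\<^esub> (c \<odot>\<^bsub>F\<^esub> x) \<in> ?W"
          using memW[of "\<ominus>\<^bsub>F\<^esub> t" y] \<pi>.A.submodule_neg[OF T.submodule_axioms t(1)] y
            submodule.smult_closed[OF W k(1)] by simp
        then have "x \<in> ?W" using k t(2) xF by (simp flip: \<pi>.A.smult_assoc1)
        then show ?thesis using xW by blast
      qed
    qed
    moreover have "?T \<subseteq> a_kernel F B \<beta>"
    proof -
      interpret k: submodule K "a_kernel F B \<beta>" F by (rule \<beta>.ker_submodule)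
      show ?thesis using T(3) x(1) by auto
    qed
    ultimately have "?T \<in> Z"
      using \<pi>.A.adjoin_graded[OF T(1) x(2)] T(2) sub by (simp add: Z_def)
    then have "?T = T" using max sub by blast
    moreover have "x \<in> ?T" using mem[OF T.zero_closed, of "\<one>\<^bsub>K\<^esub>"] xF by simp
    ultimately have "x \<oplus>\<^bsub>F\<^esub> \<zero>\<^bsub>F\<^esub> \<in> ?W" by (intro memW) simp_all
    then show False using xW xF by simp
  qed
  have "a_kernel F B \<beta> \<subseteq> ?W"
  proof
    fix x assume x: "x \<in> a_kernel F B \<beta>"
    obtain a b where ab: "a \<in> a_kernel F B \<beta>" "b \<in> a_kernel F B \<beta>" "a \<in> gr F 0" "b \<in> gr F 1"
      "x = a \<oplus>\<^bsub>F\<^esub> b" using \<pi>.A.graded_submodule_decomp[OF \<beta>.ker_graded x] .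
    show "x \<in> ?W"
      unfolding ab(5)
      by (rule submodule.m_closed[OF W homogeneous[OF ab(1,3)] homogeneous[OF ab(2,4)]])
  qed
  then show ?thesis using that T by blast
qed

lemma maximal_imp_natural:
  assumes max: "maximal_stem_extension K L B g"
    and d: "d \<in> derived K F" "\<beta> d = \<zero>\<^bsub>B\<^esub>"
  shows "d \<in> I"
proof -
  obtain T where T: "graded_submodule K F T" "I \<subseteq> T" "T \<subseteq> a_kernel F B \<beta>" "T \<inter> derived K F \<subseteq> I"
    "a_kernel F B \<beta> \<subseteq> \<pi>.A.submodule_sum T (derived K F)"
    by (rule complement_exists)
  have TR: "T \<subseteq> R" using T(3) ker_subset_R by (rule subset_trans)
  interpret T: graded_ideal K F T by (rule R.graded_ideal_between[OF T(1,2) TR])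
  define p where "p = (\<lambda>x. T +>\<^bsub>F\<^esub> x)"
  have p: "p \<in> lie_hom K F T.Q" "p ` carrier F = carrier T.Q"
    unfolding p_def by (rule T.quot_hom, rule T.quot_carrier)
  have p_zero: "p x = \<zero>\<^bsub>T.Q\<^esub> \<longleftrightarrow> x \<in> T" if "x \<in> carrier F" for x
    using T.coset_eq_iff[OF that] by (simp add: p_def T.quot_zero)
  note lieF = \<pi>.A.lie_superalgebra_axioms and lieL = \<pi>.B.lie_superalgebra_axioms
    and lieB = g.A.lie_superalgebra_axioms and lieQ = T.quot_lie_superalgebra
  have p_ker: "\<pi> x = \<zero>\<^bsub>L\<^esub>" if "x \<in> carrier F" "p x = \<zero>\<^bsub>T.Q\<^esub>" for x
    using that p_zero[OF that(1)] by (intro a_kernelD(2)[OF subsetD[OF TR]]) simp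
  obtain f1 where f1: "f1 \<in> lie_hom K T.Q L" "\<And>x. x \<in> carrier F \<Longrightarrow> f1 (p x) = \<pi> x"
    using lie_hom_factor_exists[OF lieF lieQ lieL p \<pi>.lie_hom p_ker] by blast
  have stemQ: "stem_extension K L T.Q f1"
  proof (rule stem_extension_image[OF ext lieQ p f1])
    fix r assume r: "r \<in> R"
    note rF = a_kernelD(1)[OF r]
    show "p (bracket F r x) = \<zero>\<^bsub>T.Q\<^esub>" if "x \<in> carrier F" for x
      using \<pi>.A.commutator_swap[OF R.graded r that] T(2) that rF
      by (subst p_zero) (auto intro: \<pi>.A.bracket_closed)
    \<comment> \<open>By \<open>kernel_onto\<close>, \<open>r\<close> agrees with a derived
      \<open>d0\<close> modulo the kernel of \<beta>. That kernel lies in \<open>T + [F, F]\<close>,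
      so modulo \<open>T\<close> the element \<open>r\<close> is itself derived.\<close>
    have "\<beta> r \<in> \<beta> ` S"
      unfolding kernel_onto using rF a_kernelD(2)[OF r] by (intro a_kernelI) (simp_all add: ext_hom_eq)
    then obtain d0 where d0: "d0 \<in> derived K F" "\<beta> r = \<beta> d0" by blast
    note d0F = \<pi>.A.derived_closed[OF d0(1)]
    have "r \<ominus>\<^bsub>F\<^esub> d0 \<in> a_kernel F B \<beta>"
      using \<beta>.eq_iff_minus[OF rF d0F] d0(2) rF d0F by (intro a_kernelI) simp_all
    then obtain t d1 where td: "t \<in> T" "d1 \<in> derived K F" "r \<ominus>\<^bsub>F\<^esub> d0 = t \<oplus>\<^bsub>F\<^esub> d1"
      using subsetD[OF T(5)] unfolding \<pi>.A.submodule_sum_iff by blast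
    have F: "t \<in> carrier F" "d1 \<in> carrier F"
      using td(1) T.T.subset \<pi>.A.derived_closed[OF td(2)] by blast+
    have "r = (r \<ominus>\<^bsub>F\<^esub> d0) \<oplus>\<^bsub>F\<^esub> d0"
      using rF d0F by (simp add: a_minus_def \<pi>.A.M.a_assoc \<pi>.A.M.l_neg)
    also have "\<dots> = t \<oplus>\<^bsub>F\<^esub> (d1 \<oplus>\<^bsub>F\<^esub> d0)" using F d0F by (simp add: td(3) \<pi>.A.M.a_assoc)
    finally have "p r = p (d1 \<oplus>\<^bsub>F\<^esub> d0)"
      using T.coset_eqI[OF \<pi>.A.M.a_closed[OF F(2) d0F] td(1)] by (simp add: p_def)
    moreover have "d1 \<oplus>\<^bsub>F\<^esub> d0 \<in> derived K F"
      by (rule submodule.m_closed[OF \<pi>.A.derived_submodule td(2) d0(1)])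
    ultimately show "\<exists>d\<in>derived K F. p r = p d" by blast
  qed
  \<comment> \<open>Maximality only tests extensions on \<open>'l list\<close>, so the quotient by
    \<open>T\<close> is replaced by a copy there.\<close>
  obtain e :: "'p set \<Rightarrow> 'l list" where e: "inj_on e (carrier T.Q)"
    using stem_extension_code[OF stemQ] .
  let ?C = "transport T.Q e"
  obtain f' where f': "stem_extension K L ?C f'" "\<And>x. x \<in> carrier T.Q \<Longrightarrow> f' (e x) = f1 x"
    using stem_extension_transport[OF stemQ e] by blast
  note tr = transport[OF lieQ e]
  define q where "q = e \<circ> p"
  have eh: "e \<in> lie_hom K T.Q ?C" "e ` carrier T.Q = carrier ?C"
    using tr(2) by (simp_all add: lie_iso_def bij_betw_def)
  have q: "q \<in> lie_hom K F ?C" "q ` carrier F = carrier ?C"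
    unfolding q_def image_comp[symmetric] p(2) eh(2) by (rule lie_hom_comp[OF p(1) eh(1)], rule refl)
  interpret q: lie_morphism K F ?C q
    by (intro lie_morphism.intro lie_morphism_axioms.intro lieF tr(1) q(1))
  have pQ: "p x \<in> carrier T.Q" if "x \<in> carrier F" for x using p(2) that by blast
  have q_zero: "x \<in> T" if "x \<in> carrier F" "q x = \<zero>\<^bsub>?C\<^esub>" for x
  proof -
    have "q x = q \<zero>\<^bsub>F\<^esub>" using that by simp
    then have "p x = p \<zero>\<^bsub>F\<^esub>"
      using inj_onD[OF e] pQ[OF that(1)] pQ[OF \<pi>.A.M.zero_closed] by (simp add: q_def)
    also have "\<dots> = \<zero>\<^bsub>T.Q\<^esub>" by (simp add: p_zero T.T.zero_closed)
    finally show ?thesis using p_zero that(1) by simp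
  qed
  have q_ker: "\<beta> x = \<zero>\<^bsub>B\<^esub>" if "x \<in> carrier F" "q x = \<zero>\<^bsub>?C\<^esub>" for x
    by (rule a_kernelD(2)[OF subsetD[OF T(3) q_zero[OF that]]])
  \<comment> \<open>Because \<open>T\<close> lies in the kernel of \<beta>, the lift factors through
    the copied quotient. The factor is the epimorphism to which maximality is applied.\<close>
  obtain h where h: "h \<in> lie_hom K ?C B" "\<And>x. x \<in> carrier F \<Longrightarrow> h (q x) = \<beta> x"
    using lie_hom_factor_exists[OF lieF tr(1) lieB q \<beta>.lie_hom q_ker] by blast
  have "f' c = g (h c)" if "c \<in> carrier ?C" for c
  proof -
    have "c \<in> q ` carrier F" using that q(2) by simp
    then obtain x where "x \<in> carrier F" "c = q x" by blast
    then show ?thesis using f'(2)[OF pQ] f1(2) h(2) ext_hom_eq by (simp add: q_def)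
  qed
  then have "h \<in> extension_hom K ?C f' B g" using h(1) by (simp add: extension_hom_def)
  moreover have "h ` carrier ?C = carrier B"
    using h(2) surj by (simp add: q(2)[symmetric] image_image)
  ultimately have "h \<in> lie_iso K ?C B"
    using max f'(1) unfolding maximal_stem_extension_def by blast
  then have inj: "inj_on h (carrier ?C)" by (simp add: lie_iso_def bij_betw_def)
  note dF = \<pi>.A.derived_closed[OF d(1)]
  \<comment> \<open>Injectivity of \<open>h\<close> turns \<open>\<beta> d = 0\<close> into
    \<open>q d = 0\<close>. Hence \<open>d\<close> lies in \<open>T\<close> and in the derived
    algebra, so in \<open>I\<close>.\<close>
  have "q d = q \<zero>\<^bsub>F\<^esub>"
  proof (rule inj_onD[OF inj])
    show "h (q d) = h (q \<zero>\<^bsub>F\<^esub>)" using h(2) dF d(2) by (simp del: q.lin.f0_is_0)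
  qed (use dF in \<open>simp_all del: q.lin.f0_is_0\<close>)
  then have "d \<in> T" using q_zero[OF dF] by simp
  then show ?thesis using T(4) d(1) by blast
qed

lemma maximal_iff_natural: "maximal_stem_extension K L B g \<longleftrightarrow> natural_stem_cover K L F \<pi> B g"
  unfolding natural_stem_cover_iff using natural_imp_maximal maximal_imp_natural by blast

lemma natural_imp_stem_cover:
  assumes "natural_stem_cover K L F \<pi> B g"
  shows "stem_cover K L F \<pi> B g"
proof -
  have "\<nu> \<in> lie_iso K SM N"
    using assms unfolding natural_stem_cover_iff natural_iso_iff .
  from lie_iso_inv[OF M.quot_lie_superalgebra kernel_lie this] show ?thesis
    using stem by (auto simp: stem_cover_def schur_multiplier_eq)
qed

text \<open>The given isomorphism \<phi> goes from the kernel to the multiplier, so \<phi> after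
  \<nu> is a surjective endomorphism of a finite-dimensional space. It is injective, and therefore
  so is \<nu>.\<close>

lemma stem_cover_imp_natural:
  assumes cover: "stem_cover K L F \<pi> B g" and fd: "vectorspace.fin_dim K (schur_multiplier K L F \<pi>)"
  shows "natural_stem_cover K L F \<pi> B g"
proof -
  obtain \<phi> where \<phi>: "\<phi> \<in> lie_iso K N SM"
    using cover by (auto simp: stem_cover_def schur_multiplier_eq)
  then have \<phi>_hom: "\<phi> \<in> lie_hom K N SM" and \<phi>_surj: "\<phi> ` carrier N = carrier SM"
    by (auto simp: lie_iso_def bij_betw_def)
  interpret SM: lie_superalgebra K SM by (rule M.quot_lie_superalgebra)
  interpret \<nu>: lie_morphism K SM N \<nu>
    by (intro lie_morphism.intro lie_morphism_axioms.intro SM.lie_superalgebra_axioms kernel_lie natural_hom)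
  interpret \<phi>: lie_morphism K N SM \<phi>
    by (intro lie_morphism.intro lie_morphism_axioms.intro SM.lie_superalgebra_axioms kernel_lie \<phi>_hom)
  have "inj_on \<nu> (carrier SM)"
  proof (rule \<nu>.inj_onI)
    fix Y assume Y: "Y \<in> carrier SM" "\<nu> Y = \<zero>\<^bsub>N\<^esub>"
    show "Y = \<zero>\<^bsub>SM\<^esub>"
    proof (rule fin_dim_surj_imp_inj[OF SM.vectorspace_axioms _ _ _ Y(1)])
      show "\<phi> \<circ> \<nu> \<in> module_hom K SM SM"
        using lie_hom_comp[OF natural_hom \<phi>_hom] by (simp add: lie_hom_def)
      show "(\<phi> \<circ> \<nu>) ` carrier SM = carrier SM"
        unfolding image_comp[symmetric] natural_surj \<phi>_surj ..
      show "vectorspace.fin_dim K SM" using fd by (simp add: schur_multiplier_eq)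
      show "(\<phi> \<circ> \<nu>) Y = \<zero>\<^bsub>SM\<^esub>" using \<phi>.lin.f0_is_0 Y(2) by simp
    qed
  qed
  then have "\<nu> \<in> lie_iso K SM N" using natural_hom natural_surj by (simp add: lie_iso_def bij_betw_def)
  then show ?thesis unfolding natural_stem_cover_iff natural_iso_iff .
qed

end

text \<open>The equivalence is stated for the natural map in every dimension. For an abstract
  isomorphism the reverse implication rests on finite dimension, where a surjective endomorphism of
  the multiplier is injective.\<close>

theorem corollary3p7:
  fixes K :: "'f ring"
    and L :: "('f, 'l) superalgebra"
    and X :: "bit \<Rightarrow> 'x set" and i :: "'x \<Rightarrow> 'p"
    and F :: "('f, 'p) superalgebra" and \<pi> :: "'p \<Rightarrow> 'l"
    and A :: "('f, 'a) superalgebra" and f :: "'a \<Rightarrow> 'l"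
  assumes "field K"
    and char_not_2: "[(2::nat)] \<cdot>\<^bsub>K\<^esub> \<one>\<^bsub>K\<^esub> \<noteq> \<zero>\<^bsub>K\<^esub>"
    and char_not_3: "[(3::nat)] \<cdot>\<^bsub>K\<^esub> \<one>\<^bsub>K\<^esub> \<noteq> \<zero>\<^bsub>K\<^esub>"
    and "lie_superalgebra K L"
    and "free_presentation K L X i F \<pi>"
    and "stem_extension K L A f"
  shows "(maximal_stem_extension K L A f \<longleftrightarrow> natural_stem_cover K L F \<pi> A f) \<and>
    (maximal_stem_extension K L A f \<longrightarrow> stem_cover K L F \<pi> A f) \<and>
    (vectorspace.fin_dim K (schur_multiplier K L F \<pi>) \<longrightarrow>
      (maximal_stem_extension K L A f \<longleftrightarrow> stem_cover K L F \<pi> A f))"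
proof -
  interpret P: lie_free_presentation K L X i F \<pi>
    by (rule lie_free_presentation.intro) fact
  obtain \<beta> where \<beta>: "\<beta> \<in> extension_hom K F \<pi> A f"
    using P.lift_exists[OF \<open>stem_extension K L A f\<close>] .
  interpret stem_lift K L X i F \<pi> A f \<beta>
    by (intro stem_lift.intro stem_lift_axioms.intro P.lie_free_presentation_axioms \<beta>) fact
  show ?thesis
    using maximal_iff_natural natural_imp_stem_cover stem_cover_imp_natural by blast
qed

end
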